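(* Let $(V,d)$ be a finite (extended) metric space and let $\gamma\colon V\to[0,\infty]$ be a function. Define $G_\gamma\colon V\times V\to[0,\infty]^2$ by $G_\gamma(v,v')=(d(v,v'),\gamma(v))$, and let $\otimes$ be the coordinatewise supremum on $[0,\infty]^2$. Then the geometric realizations of $R^{t,s}_\otimes(G_\gamma)$ and $\operatorname{Rips}^\uparrow(\gamma)_{t,s}$ are naturally homotopy equivalent for all $s,t\in[0,\infty]$ (natural with respect to the inclusions in the two filtrations over $(t,s)\in[0,\infty]^2$). In particular, the two filtrations have isomorphic persistent homology.
   Context: An extended metric is a metric allowed to take the value $\infty$. The sublevel Rips bifiltration $\operatorname{Rips}^\uparrow(\gamma)$ is the filtered simplicial complex whose value at $(t,s)\in[0,\infty]^2$ is the Rips complex of $\gamma^{-1}[0,s]$ at scale $t$: a (nonempty) $\sigma\subseteq V$ is a simplex of $\operatorname{Rips}^\uparrow(\gamma)_{t,s}$ if and only if $\gamma(v)\leq s$ and $d(v,v')\leq t$ for all $v,v'\in\sigma$. Let $L=[0,\infty]^2$ with the product order, and let $\otimes$ be the binary supremum on $L$, with neutral element $(0,0)$. For an $L$-graph, i.e. a function $G\colon V\times V\to L$ with $V$ finite, and a tuple $(v_0,\dots,v_n)\in V^{n+1}$, set $\mathcal{L}^G_\otimes(v_0,\dots,v_n)=G(v_0,v_0)$ if $v_0=v_1=\dots=v_n$, and otherwise $\mathcal{L}^G_\otimes(v_0,\dots,v_n)=\bigotimes_{i:\,v_{i-1}\neq v_i}G(v_{i-1},v_i)$, the product over indices $i\in\{1,\dots,n\}$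 with $v_{i-1}\neq v_i$. For an order-preserving map $\alpha\colon[m]\to[n]$, where $[k]=\{0,\dots,k\}$, and $y=(v_0,\dots,v_n)$, write $\alpha^*y=(v_{\alpha(0)},\dots,v_{\alpha(m)})$. For $(t,s)\in L$, $R^{t,s}_\otimes(G)$ is the simplicial set with $n$-simplices $$R^{t,s}_\otimes(G)_n=\{y\in V^{n+1}\mid \mathcal{L}^G_\otimes(\alpha^*y)\leq (t,s)\text{ for all } m\geq 0 \text{ and all order-preserving }\alpha\colon[m]\to[n]\}$$ and structure maps $y\mapsto\alpha^*y$. These form an $L$-filtered simplicial set under inclusions (the monoidal Rips filtration of $G$). Persistent homology of a filtered simplicial set or complex is the functor sending a filtration degree to the homology (with coefficients in a fixed field) of the corresponding stage, with maps induced by inclusions. *)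

theory Defs
  imports "HOL-Analysis.Analysis" "HOL-Algebra.Module" "HOL-Homology.Simplices"
    "HOL-Library.Poly_Mapping"
begin

section \<open>Simplicial sets\<close>

definition simplex_maps :: "nat \<Rightarrow> nat \<Rightarrow> (nat \<Rightarrow> nat) set"
  where "simplex_maps m n = {\<alpha>. mono_on {..m} \<alpha> \<and> \<alpha> ` {..m} \<subseteq> {..n}}"

text \<open>\<^term>\<open>pull X m n \<alpha>\<close> is the structure map from \<open>n\<close>-simplices to \<open>m\<close>-simplices along
  \<open>\<alpha>: [m] \<rightarrow> [n]\<close>. Order-preserving maps are represented by total functions on the naturals, of
  which only the values on \<open>{..m}\<close> are relevant.\<close>

record 'x sset =
  simp :: "nat \<Rightarrow> 'x set"
  pull :: "nat \<Rightarrow> nat \<Rightarrow> (nat \<Rightarrow> nat) \<Rightarrow> 'x \<Rightarrow> 'x"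

locale simplicial_set =
  fixes X :: "'x sset"
  assumes pull_closed: "\<lbrakk>\<alpha> \<in> simplex_maps m n; y \<in> simp X n\<rbrakk> \<Longrightarrow> pull X m n \<alpha> y \<in> simp X m"
    and pull_ident: "y \<in> simp X n \<Longrightarrow> pull X n n (\<lambda>i. i) y = y"
    and pull_comp: "\<lbrakk>\<alpha> \<in> simplex_maps l m; \<beta> \<in> simplex_maps m n; y \<in> simp X n\<rbrakk>
          \<Longrightarrow> pull X l m \<alpha> (pull X m n \<beta> y) = pull X l n (\<beta> \<circ> \<alpha>) y"
    and pull_cong: "\<lbrakk>\<alpha> \<in> simplex_maps m n; \<And>i. i \<le> m \<Longrightarrow> \<beta> i = \<alpha> i; y \<in> simp X n\<rbrakk>
          \<Longrightarrow> pull X m n \<beta> y = pull X m n \<alpha> y"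

section \<open>Geometric realization of simplicial sets\<close>

definition quotient_topology :: "'a topology \<Rightarrow> ('a \<times> 'a) set \<Rightarrow> 'a set topology"
  where "quotient_topology X r = topology (\<lambda>U. U \<subseteq> topspace X // r \<and>
           openin X {x \<in> topspace X. r `` {x} \<in> U})"

lemma openin_quotient_topology:
  "openin (quotient_topology X r) U \<longleftrightarrow>
     U \<subseteq> topspace X // r \<and> openin X {x \<in> topspace X. r `` {x} \<in> U}"
proof -
  have 1: "{x \<in> topspace X. r `` {x} \<in> S \<inter> T} =
      {x \<in> topspace X. r `` {x} \<in> S} \<inter> {x \<in> topspace X. r `` {x} \<in> T}" for S T
    by auto
  have 2: "{x \<in> topspace X. r `` {x} \<in> \<Union>\<K>} = (\<Union>K\<in>\<K>. {x \<in> topspace X. r `` {x} \<in> K})" for \<K>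
    by auto
  have "istopology (\<lambda>U. U \<subseteq> topspace X // r \<and> openin X {x \<in> topspace X. r `` {x} \<in> U})"
    unfolding istopology_def 1 2 by blast
  then show ?thesis
    by (simp add: quotient_topology_def)
qed

lemma topspace_quotient_topology [simp]:
  "topspace (quotient_topology X r) = topspace X // r"
proof -
  have "{x \<in> topspace X. r `` {x} \<in> topspace X // r} = topspace X"
    by (auto simp: quotient_def)
  then have "openin (quotient_topology X r) (topspace X // r)"
    by (simp add: openin_quotient_topology)
  moreover have "topspace (quotient_topology X r) \<subseteq> topspace X // r"
    using openin_quotient_topology openin_topspace by blast
  ultimately show ?thesis
    by (meson openin_subset subset_antisym)
qed

text \<open>The affine map of standard simplices induced by \<open>\<alpha>: [m] \<rightarrow> [n]\<close>, in barycentric coordinates.\<close>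

definition simplex_push :: "nat \<Rightarrow> (nat \<Rightarrow> nat) \<Rightarrow> (nat \<Rightarrow> real) \<Rightarrow> nat \<Rightarrow> real"
  where "simplex_push m \<alpha> l = (\<lambda>j. \<Sum>i | i \<le> m \<and> \<alpha> i = j. l i)"

definition prerealization :: "'x sset \<Rightarrow> (nat \<times> 'x \<times> (nat \<Rightarrow> real)) topology"
  where "prerealization X = sum_topology (\<lambda>n. prod_topology (discrete_topology (simp X n))
           (subtopology (powertop_real UNIV) (standard_simplex n))) UNIV"

inductive realization_glue ::
    "'x sset \<Rightarrow> nat \<times> 'x \<times> (nat \<Rightarrow> real) \<Rightarrow> nat \<times> 'x \<times> (nat \<Rightarrow> real) \<Rightarrow> bool"
  for X where
  "\<lbrakk>\<alpha> \<in> simplex_maps m n; y \<in> simp X n; l \<in> standard_simplex m\<rbrakk>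
    \<Longrightarrow> realization_glue X (m, pull X m n \<alpha> y, l) (n, y, simplex_push m \<alpha> l)"

definition realization_rel ::
    "'x sset \<Rightarrow> ((nat \<times> 'x \<times> (nat \<Rightarrow> real)) \<times> (nat \<times> 'x \<times> (nat \<Rightarrow> real))) set"
  where "realization_rel X = {(a, b). a \<in> topspace (prerealization X) \<and>
           b \<in> topspace (prerealization X) \<and> equivclp (realization_glue X) a b}"

lemma equiv_realization_rel: "equiv (topspace (prerealization X)) (realization_rel X)"
proof (rule equivI)
  show "realization_rel X \<subseteq> topspace (prerealization X) \<times> topspace (prerealization X)"
    by (auto simp: realization_rel_def)
  show "refl_on (topspace (prerealization X)) (realization_rel X)"
    by (auto simp: realization_rel_def refl_on_def)
  show "sym (realization_rel X)"
    unfolding realization_rel_def sym_def by (blast dest: equivclp_sym)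
  show "trans (realization_rel X)"
    unfolding realization_rel_def trans_def by (blast intro: equivclp_trans)
qed

definition realization :: "'x sset \<Rightarrow> (nat \<times> 'x \<times> (nat \<Rightarrow> real)) set topology"
  where "realization X = quotient_topology (prerealization X) (realization_rel X)"

text \<open>The map into the realization of \<open>Y\<close> induced by the inclusion of a simplicial subset: a point
  \<open>c\<close>, which is a class of pairs (simplex, coordinates), is sent to the class of \<open>Y\<close> containing it.\<close>

definition realization_incl ::
    "'x sset \<Rightarrow> (nat \<times> 'x \<times> (nat \<Rightarrow> real)) set \<Rightarrow> (nat \<times> 'x \<times> (nat \<Rightarrow> real)) set"
  where "realization_incl Y c = realization_rel Y `` c"

section \<open>Simplicial complexes and their geometric realization\<close>

definition abstract_simplicial_complex :: "'v set set \<Rightarrow> bool"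
  where "abstract_simplicial_complex K \<longleftrightarrow>
     (\<forall>\<sigma>\<in>K. finite \<sigma> \<and> \<sigma> \<noteq> {} \<and> (\<forall>\<tau>. \<tau> \<subseteq> \<sigma> \<and> \<tau> \<noteq> {} \<longrightarrow> \<tau> \<in> K))"

definition geometric_face :: "'v set \<Rightarrow> ('v \<Rightarrow> real) set"
  where "geometric_face \<sigma> = {x. (\<forall>v. 0 \<le> x v) \<and> (\<forall>v. v \<notin> \<sigma> \<longrightarrow> x v = 0) \<and> sum x \<sigma> = 1}"

text \<open>The realization carries the coherent (weak) topology with respect to its closed faces. The
  realization of a subcomplex is literally a subset, so that inclusions of complexes induce the
  identity on points.\<close>

definition complex_realization :: "'v set set \<Rightarrow> ('v \<Rightarrow> real) topology"
  where "complex_realization K = topology (\<lambda>U. U \<subseteq> \<Union>(geometric_face ` K) \<and>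
           (\<forall>\<sigma>\<in>K. openin (subtopology (powertop_real UNIV) (geometric_face \<sigma>))
              (U \<inter> geometric_face \<sigma>)))"

lemma openin_complex_realization:
  fixes K :: "'v set set"
  shows "openin (complex_realization K) U \<longleftrightarrow> U \<subseteq> \<Union>(geometric_face ` K) \<and>
     (\<forall>\<sigma>\<in>K. openin (subtopology (powertop_real UNIV) (geometric_face \<sigma>)) (U \<inter> geometric_face \<sigma>))"
proof -
  have 1: "S \<inter> T \<inter> F = (S \<inter> F) \<inter> (T \<inter> F)" for S T F :: "('v \<Rightarrow> real) set"
    by auto
  have 2: "\<Union>\<K> \<inter> F = (\<Union>S\<in>\<K>. S \<inter> F)" for \<K> and F :: "('v \<Rightarrow> real) set"
    by auto
  have "istopology (\<lambda>U. U \<subseteq> \<Union>(geometric_face ` K) \<and>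
     (\<forall>\<sigma>\<in>K. openin (subtopology (powertop_real UNIV) (geometric_face \<sigma>)) (U \<inter> geometric_face \<sigma>)))"
    unfolding istopology_def
  proof (intro conjI allI impI)
    fix S T :: "('v \<Rightarrow> real) set"
    assume S: "S \<subseteq> \<Union>(geometric_face ` K) \<and> (\<forall>\<sigma>\<in>K. openin
        (subtopology (powertop_real UNIV) (geometric_face \<sigma>)) (S \<inter> geometric_face \<sigma>))"
      and T: "T \<subseteq> \<Union>(geometric_face ` K) \<and> (\<forall>\<sigma>\<in>K. openin
        (subtopology (powertop_real UNIV) (geometric_face \<sigma>)) (T \<inter> geometric_face \<sigma>))"
    show "S \<inter> T \<subseteq> \<Union>(geometric_face ` K)"
      using S by blast
    show "\<forall>\<sigma>\<in>K. openin (subtopology (powertop_real UNIV) (geometric_face \<sigma>))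
        (S \<inter> T \<inter> geometric_face \<sigma>)"
    proof
      fix \<sigma> assume "\<sigma> \<in> K"
      then show "openin (subtopology (powertop_real UNIV) (geometric_face \<sigma>))
          (S \<inter> T \<inter> geometric_face \<sigma>)"
        using S T by (subst 1) (blast intro: openin_Int)
    qed
  next
    fix \<K> :: "('v \<Rightarrow> real) set set"
    assume K: "\<forall>S\<in>\<K>. S \<subseteq> \<Union>(geometric_face ` K) \<and> (\<forall>\<sigma>\<in>K. openin
        (subtopology (powertop_real UNIV) (geometric_face \<sigma>)) (S \<inter> geometric_face \<sigma>))"
    show "\<Union>\<K> \<subseteq> \<Union>(geometric_face ` K)"
      using K by blast
    show "\<forall>\<sigma>\<in>K. openin (subtopology (powertop_real UNIV) (geometric_face \<sigma>))
        (\<Union>\<K> \<inter> geometric_face \<sigma>)"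
      unfolding 2 using K by blast
  qed
  then show ?thesis
    by (simp add: complex_realization_def)
qed

section \<open>Natural homotopy equivalences of filtered spaces\<close>

definition homotopy_equivalence_map :: "'a topology \<Rightarrow> 'b topology \<Rightarrow> ('a \<Rightarrow> 'b) \<Rightarrow> bool"
  where "homotopy_equivalence_map X Y f \<longleftrightarrow> continuous_map X Y f \<and>
     (\<exists>g. continuous_map Y X g \<and>
        homotopic_with (\<lambda>x. True) X X (g \<circ> f) id \<and>
        homotopic_with (\<lambda>x. True) Y Y (f \<circ> g) id)"

text \<open>A natural transformation between two diagrams of spaces, with transition maps \<open>\<xi> i j\<close> and
  \<open>\<eta> i j\<close> for \<open>i \<le> j\<close>, that is a homotopy equivalence at every index.\<close>

definition natural_homotopy_equivalence ::
    "('i::order \<Rightarrow> 'a topology) \<Rightarrow> ('i \<Rightarrow> 'i \<Rightarrow> 'a \<Rightarrow> 'a) \<Rightarrow>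
     ('i \<Rightarrow> 'b topology) \<Rightarrow> ('i \<Rightarrow> 'i \<Rightarrow> 'b \<Rightarrow> 'b) \<Rightarrow> ('i \<Rightarrow> 'a \<Rightarrow> 'b) \<Rightarrow> bool"
  where "natural_homotopy_equivalence X \<xi> Y \<eta> f \<longleftrightarrow>
     (\<forall>i. homotopy_equivalence_map (X i) (Y i) (f i)) \<and>
     (\<forall>i j. i \<le> j \<longrightarrow> (\<forall>x \<in> topspace (X i). f j (\<xi> i j x) = \<eta> i j (f i x)))"

section \<open>Homology with field coefficients\<close>

text \<open>A chain complex of free modules, given by a basis in each degree and the boundary
  (one degree lower) of each basis element. Chains are finitely supported functions.\<close>

record (overloaded) ('x, 'k) based_complex =
  basis :: "nat \<Rightarrow> 'x set"
  basis_bdry :: "nat \<Rightarrow> 'x \<Rightarrow> ('x \<Rightarrow>\<^sub>0 'k)"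

definition chain_scale :: "'k::field \<Rightarrow> ('x \<Rightarrow>\<^sub>0 'k) \<Rightarrow> ('x \<Rightarrow>\<^sub>0 'k)"
  where "chain_scale a c = Poly_Mapping.map (\<lambda>b. a * b) c"

definition based_chains :: "('x, 'k::field) based_complex \<Rightarrow> nat \<Rightarrow> ('x \<Rightarrow>\<^sub>0 'k) set"
  where "based_chains C n = {c. Poly_Mapping.keys c \<subseteq> basis C n}"

definition bdry :: "('x, 'k::field) based_complex \<Rightarrow> nat \<Rightarrow> ('x \<Rightarrow>\<^sub>0 'k) \<Rightarrow> ('x \<Rightarrow>\<^sub>0 'k)"
  where "bdry C n c = (\<Sum>x\<in>Poly_Mapping.keys c.
           chain_scale (Poly_Mapping.lookup c x) (basis_bdry C n x))"

definition based_cycles :: "('x, 'k::field) based_complex \<Rightarrow> nat \<Rightarrow> ('x \<Rightarrow>\<^sub>0 'k) set"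
  where "based_cycles C n = {c \<in> based_chains C n. n = 0 \<or> bdry C n c = 0}"

definition based_boundaries :: "('x, 'k::field) based_complex \<Rightarrow> nat \<Rightarrow> ('x \<Rightarrow>\<^sub>0 'k) set"
  where "based_boundaries C n = bdry C (Suc n) ` based_chains C (Suc n)"

text \<open>Homology classes are cosets \<open>z +o B\<close> of the boundaries, where sums of sets are elementwise;
  adding \<open>B\<close> in the scalar multiplication only matters for the scalar 0. The ring
  multiplication that HOL-Algebra's module record inherits is irrelevant.\<close>

definition homology :: "('x, 'k::field) based_complex \<Rightarrow> nat \<Rightarrow> ('k, ('x \<Rightarrow>\<^sub>0 'k) set) module"
  where "homology C n =
    \<lparr> carrier = {z +o based_boundaries C n |z. z \<in> based_cycles C n},
      monoid.mult = undefined,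
      monoid.one = undefined,
      ring.zero = based_boundaries C n,
      ring.add = (\<lambda>A A'. A + A'),
      smult = (\<lambda>a A. chain_scale a ` A + based_boundaries C n) \<rparr>"

text \<open>The map into the homology of \<open>D\<close> induced by the inclusion of a subcomplex.\<close>

definition homology_incl ::
    "('x, 'k::field) based_complex \<Rightarrow> nat \<Rightarrow> ('x \<Rightarrow>\<^sub>0 'k) set \<Rightarrow> ('x \<Rightarrow>\<^sub>0 'k) set"
  where "homology_incl D n A = A + based_boundaries D n"

definition coface :: "nat \<Rightarrow> nat \<Rightarrow> nat"
  where "coface i j = (if j < i then j else Suc j)"

definition sset_complex :: "'x sset \<Rightarrow> ('x, 'k::field) based_complex"
  where "sset_complex X =
    \<lparr> basis = simp X,
      basis_bdry = (\<lambda>n x. if n = 0 then 0 else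
        (\<Sum>i\<le>n. Poly_Mapping.single (pull X (n - 1) n (coface i) x) ((-1) ^ i))) \<rparr>"

text \<open>The simplicial chain complex of an abstract simplicial complex, where every simplex is oriented
  by the linear order \<open>r\<close> on the vertices: if \<open>v\<close> is the \<open>i\<close>-th vertex (counting from 0) of
  \<open>\<sigma>\<close>, the face opposite to \<open>v\<close> has sign \<open>(-1)^i\<close>.\<close>

definition ordered_complex :: "('v \<times> 'v) set \<Rightarrow> 'v set set \<Rightarrow> ('v set, 'k::field) based_complex"
  where "ordered_complex r K =
    \<lparr> basis = (\<lambda>n. {\<sigma> \<in> K. card \<sigma> = Suc n}),
      basis_bdry = (\<lambda>n \<sigma>. if n = 0 then 0 else
        (\<Sum>v\<in>\<sigma>. Poly_Mapping.single (\<sigma> - {v}) ((-1) ^ card {w \<in> \<sigma>. w \<noteq> v \<and> (w, v) \<in> r}))) \<rparr>"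

section \<open>Persistence modules\<close>

type_synonym ('i, 'k, 'a) persistence_module =
  "('i \<Rightarrow> ('k, 'a) module) \<times> ('i \<Rightarrow> 'i \<Rightarrow> 'a \<Rightarrow> 'a)"

definition persistent_homology ::
    "nat \<Rightarrow> ('i \<Rightarrow> ('x, 'k::field) based_complex) \<Rightarrow> ('i, 'k, ('x \<Rightarrow>\<^sub>0 'k) set) persistence_module"
  where "persistent_homology n C = (\<lambda>i. homology (C i) n, \<lambda>i j. homology_incl (C j) n)"

definition linear_iso :: "('k, 'a) module \<Rightarrow> ('k, 'b) module \<Rightarrow> ('a \<Rightarrow> 'b) \<Rightarrow> bool"
  where "linear_iso M N \<phi> \<longleftrightarrow> bij_betw \<phi> (carrier M) (carrier N) \<and>
     (\<forall>x\<in>carrier M. \<forall>y\<in>carrier M. \<phi> (x \<oplus>\<^bsub>M\<^esub> y) = \<phi> x \<oplus>\<^bsub>N\<^esub> \<phi> y) \<and>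
     (\<forall>a. \<forall>x\<in>carrier M. \<phi> (a \<odot>\<^bsub>M\<^esub> x) = a \<odot>\<^bsub>N\<^esub> \<phi> x)"

definition isomorphic_persistence_modules ::
    "('i::order, 'k, 'a) persistence_module \<Rightarrow> ('i, 'k, 'b) persistence_module \<Rightarrow> bool"
  where "isomorphic_persistence_modules M N \<longleftrightarrow>
     (\<exists>\<phi>. (\<forall>i. linear_iso (fst M i) (fst N i) (\<phi> i)) \<and>
        (\<forall>i j. i \<le> j \<longrightarrow> (\<forall>x \<in> carrier (fst M i). \<phi> j (snd M i j x) = snd N i j (\<phi> i x))))"

section \<open>The monoidal Rips filtration\<close>

definition reindex :: "nat \<Rightarrow> (nat \<Rightarrow> nat) \<Rightarrow> 'v list \<Rightarrow> 'v list"
  where "reindex m \<alpha> y = map (\<lambda>i. y ! \<alpha> i) [0..<Suc m]"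

text \<open>Here \<open>e\<close> is the neutral element of \<open>\<otimes>\<close>, and a tuple \<open>(v\<^sub>0, \<dots>, v\<^sub>n)\<close> is
  a list of length \<open>n + 1\<close>.\<close>

definition monoidal_length :: "('l \<Rightarrow> 'l \<Rightarrow> 'l) \<Rightarrow> 'l \<Rightarrow> ('v \<Rightarrow> 'v \<Rightarrow> 'l) \<Rightarrow> 'v list \<Rightarrow> 'l"
  where "monoidal_length otimes e G y =
    (if \<forall>v\<in>set y. v = hd y then G (hd y) (hd y)
     else foldr otimes
       (map (\<lambda>i. G (y ! (i - 1)) (y ! i)) (filter (\<lambda>i. y ! (i - 1) \<noteq> y ! i) [1..<length y])) e)"

definition monoidal_rips ::
    "('l::order \<Rightarrow> 'l \<Rightarrow> 'l) \<Rightarrow> 'l \<Rightarrow> ('v \<Rightarrow> 'v \<Rightarrow> 'l) \<Rightarrow> 'v set \<Rightarrow> 'l \<Rightarrow> 'v list sset"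
  where "monoidal_rips otimes e G V p =
    \<lparr> simp = (\<lambda>n. {y. length y = Suc n \<and> set y \<subseteq> V \<and>
        (\<forall>m. \<forall>\<alpha>\<in>simplex_maps m n. monoidal_length otimes e G (reindex m \<alpha> y) \<le> p)}),
      pull = (\<lambda>m n. reindex m) \<rparr>"

lemma simplicial_set_monoidal_rips: "simplicial_set (monoidal_rips otimes e G V p)"
proof
  have comp: "\<beta> \<circ> \<alpha> \<in> simplex_maps l n" if "\<alpha> \<in> simplex_maps l m" "\<beta> \<in> simplex_maps m n"
    for \<alpha> \<beta> l m n
    using that by (auto simp: simplex_maps_def mono_on_def image_subset_iff)
  have reindex_comp: "reindex l \<alpha> (reindex m \<beta> y) = reindex l (\<beta> \<circ> \<alpha>) y"
    if "\<alpha> \<in> simplex_maps l m" for \<alpha> \<beta> l m and y :: "'a list"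
  proof (rule nth_equalityI)
    fix i assume "i < length (reindex l \<alpha> (reindex m \<beta> y))"
    then have i: "i < Suc l" by (simp add: reindex_def)
    then have "\<alpha> i < Suc m"
      using that by (auto simp: simplex_maps_def image_subset_iff less_Suc_eq_le)
    with i show "reindex l \<alpha> (reindex m \<beta> y) ! i = reindex l (\<beta> \<circ> \<alpha>) y ! i"
      by (simp add: reindex_def del: upt_Suc)
  qed (simp add: reindex_def)
  let ?X = "monoidal_rips otimes e G V p"
  show "pull ?X m n \<alpha> y \<in> simp ?X m" if "\<alpha> \<in> simplex_maps m n" "y \<in> simp ?X n" for \<alpha> m n y
  proof -
    have "y ! \<alpha> i \<in> set y" if "i < Suc m" for i
      using \<open>\<alpha> \<in> simplex_maps m n\<close> \<open>y \<in> simp ?X n\<close> that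
      by (intro nth_mem) (auto simp: monoidal_rips_def simplex_maps_def image_subset_iff less_Suc_eq_le)
    then have "set (reindex m \<alpha> y) \<subseteq> set y"
      by (auto simp: reindex_def simp del: upt_Suc)
    moreover have "monoidal_length otimes e G (reindex l \<beta> (reindex m \<alpha> y)) \<le> p"
      if "\<beta> \<in> simplex_maps l m" for l \<beta>
      using comp[OF that \<open>\<alpha> \<in> simplex_maps m n\<close>] reindex_comp[OF that] \<open>y \<in> simp ?X n\<close>
      by (simp add: monoidal_rips_def)
    moreover have "length (reindex m \<alpha> y) = Suc m"
      by (simp add: reindex_def)
    ultimately show ?thesis
      using that by (auto simp: monoidal_rips_def)
  qed
  show "pull ?X n n (\<lambda>i. i) y = y" if "y \<in> simp ?X n" for n y
    using that map_nth[of y] by (simp add: monoidal_rips_def reindex_def del: upt_Suc)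
  show "pull ?X l m \<alpha> (pull ?X m n \<beta> y) = pull ?X l n (\<beta> \<circ> \<alpha>) y"
    if "\<alpha> \<in> simplex_maps l m" for \<alpha> \<beta> l m n y
    using reindex_comp[OF that] by (simp add: monoidal_rips_def)
  show "pull ?X m n \<beta> y = pull ?X m n \<alpha> y" if "\<And>i. i \<le> m \<Longrightarrow> \<beta> i = \<alpha> i" for \<alpha> \<beta> m n y
    using that by (simp add: monoidal_rips_def reindex_def less_Suc_eq_le del: upt_Suc)
qed

lemma monoidal_rips_mono:
  "p \<le> q \<Longrightarrow> simp (monoidal_rips otimes e G V p) n \<subseteq> simp (monoidal_rips otimes e G V q) n"
  by (auto simp: monoidal_rips_def intro: order_trans)

section \<open>The sublevel Rips bifiltration\<close>

definition extended_metric_on :: "'v set \<Rightarrow> ('v \<Rightarrow> 'v \<Rightarrow> ennreal) \<Rightarrow> bool"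
  where "extended_metric_on V d \<longleftrightarrow>
     (\<forall>x\<in>V. \<forall>y\<in>V. d x y = 0 \<longleftrightarrow> x = y) \<and>
     (\<forall>x\<in>V. \<forall>y\<in>V. d x y = d y x) \<and>
     (\<forall>x\<in>V. \<forall>y\<in>V. \<forall>z\<in>V. d x z \<le> d x y + d y z)"

definition sublevel_rips ::
    "'v set \<Rightarrow> ('v \<Rightarrow> 'v \<Rightarrow> ennreal) \<Rightarrow> ('v \<Rightarrow> ennreal) \<Rightarrow> ennreal \<times> ennreal \<Rightarrow> 'v set set"
  where "sublevel_rips V d \<gamma> = (\<lambda>(t, s). {\<sigma>. \<sigma> \<subseteq> V \<and> finite \<sigma> \<and> \<sigma> \<noteq> {} \<and>
           (\<forall>v\<in>\<sigma>. \<forall>v'\<in>\<sigma>. \<gamma> v \<le> s \<and> d v v' \<le> t)})"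

lemma abstract_simplicial_complex_sublevel_rips:
  "abstract_simplicial_complex (sublevel_rips V d \<gamma> p)"
proof (cases p)
  case (Pair t s)
  show ?thesis
    unfolding abstract_simplicial_complex_def
  proof (intro ballI conjI allI impI)
    fix \<sigma> assume \<sigma>: "\<sigma> \<in> sublevel_rips V d \<gamma> p"
    then show "finite \<sigma>" "\<sigma> \<noteq> {}"
      by (simp_all add: sublevel_rips_def Pair)
    fix \<tau> assume \<tau>: "\<tau> \<subseteq> \<sigma> \<and> \<tau> \<noteq> {}"
    then have "finite \<tau>"
      using \<open>finite \<sigma>\<close> finite_subset by blast
    with \<sigma> \<tau> show "\<tau> \<in> sublevel_rips V d \<gamma> p"
      unfolding sublevel_rips_def Pair by blast
  qed
qed

lemma sublevel_rips_mono: "p \<le> q \<Longrightarrow> sublevel_rips V d \<gamma> p \<subseteq> sublevel_rips V d \<gamma> q"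
  by (cases p; cases q) (auto simp: sublevel_rips_def dest: order_trans)

definition sublevel_graph ::
    "('v \<Rightarrow> 'v \<Rightarrow> ennreal) \<Rightarrow> ('v \<Rightarrow> ennreal) \<Rightarrow> 'v \<Rightarrow> 'v \<Rightarrow> ennreal \<times> ennreal"
  where "sublevel_graph d \<gamma> = (\<lambda>v v'. (d v v', \<gamma> v))"

text \<open>\<^const>\<open>sup\<close> and the order on pairs are componentwise (product order from HOL-Library).\<close>

definition sublevel_monoidal_rips ::
    "'v set \<Rightarrow> ('v \<Rightarrow> 'v \<Rightarrow> ennreal) \<Rightarrow> ('v \<Rightarrow> ennreal) \<Rightarrow> ennreal \<times> ennreal \<Rightarrow> 'v list sset"
  where "sublevel_monoidal_rips V d \<gamma> = monoidal_rips sup (0, 0) (sublevel_graph d \<gamma>) V"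

end

theory Submission
  imports Defs
begin

text \<open>
  For an extended metric \<open>d\<close>, a tuple is a simplex of the monoidal Rips complex at \<open>p = (t, s)\<close> if and only
  if the set of its entries is a simplex of the sublevel Rips complex \<open>K\<^sub>p\<close>
  (\<open>sublevel_monoidal_rips_eq_tuple_sset\<close>). The claim thus concerns an arbitrary finite simplicial
  complex \<open>K\<close> and the simplicial set \<open>T(K)\<close> of all tuples, degenerate ones included, whose
  entries span a simplex of \<open>K\<close>.

  \<^bold>\<open>Homotopy equivalence.\<close> The map from the realization of \<open>T(K)\<close> to that of \<open>K\<close> sends a point with
  coordinates \<open>l\<close> on the tuple \<open>y\<close> to the convex combination \<open>\<Sum>\<^sub>i l\<^sub>i y\<^sub>i\<close> of vertices. This formula does not
  mention \<open>K\<close>, so the map is natural for inclusions. Fixing a list of all vertices gives a section: a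
  point of a simplex is placed on the tuple that lists the vertices of this simplex in the fixed order. The
  section followed by the natural map is the identity. For the other composite, let \<open>z\<close> be the list of the
  entries of \<open>y\<close> in the fixed order. The concatenation \<open>y @ z\<close> is again a simplex of \<open>T(K)\<close>, and inside it
  a straight line leads from a point of the block \<open>y\<close> to its image on the block \<open>z\<close>. These lines respect
  the face and degeneracy maps (\<open>join_homotopy_glue\<close>), hence they define a homotopy to the
  identity (\<open>homotopy_equivalence_realization_to_complex\<close>).

  \<^bold>\<open>Persistent homology.\<close> The chains on tuples and the oriented chains of \<open>K\<close> are compared by acyclic
  carriers. For each nonempty \<open>\<sigma> \<subseteq> V\<close>, both the tuples in \<open>\<sigma>\<close> and the nonempty subsets of \<open>\<sigma>\<close> span a
  contractible complex, since one can form cones with a vertex of \<open>\<sigma>\<close>. Therefore chain maps in both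
  directions, and homotopies between the composites and the identities, can be chosen on the full simplex
  over \<open>V\<close> in such a way that no basis element leaves its own support (\<open>ex_carried_map\<close>,
  \<open>ex_carried_homotopy\<close>). They restrict to every subcomplex \<open>K\<^sub>p\<close>, and the
  restrictions commute with inclusions (\<open>coned_complexes_isomorphic\<close>). Since the chain
  maps are obtained by solving boundary equations, signs of permutations never enter.
\<close>

section \<open>Linear extension of maps given on a basis\<close>

lemma lookup_chain_scale [simp]:
  "Poly_Mapping.lookup (chain_scale a c) x = a * Poly_Mapping.lookup c x"
  by (simp add: chain_scale_def map.rep_eq when_def)

lemma chain_scale_algebra:
  "chain_scale a (c + c') = chain_scale a c + chain_scale a c'"
  "chain_scale a (c - c') = chain_scale a c - chain_scale a c'"
  "chain_scale (a + b) c = chain_scale a c + chain_scale b c"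
  "chain_scale a (chain_scale b c) = chain_scale (a * b) c"
  "chain_scale a 0 = 0" "chain_scale 0 c = 0" "chain_scale 1 c = c"
  by (auto intro!: poly_mapping_eqI simp: lookup_add lookup_minus algebra_simps)

lemma chain_scale_minus: "chain_scale (- a) c = - chain_scale a c"
  by (auto intro!: poly_mapping_eqI)

lemma chain_scale_single [simp]:
  "chain_scale a (Poly_Mapping.single x b) = Poly_Mapping.single x (a * b)"
  by (auto intro!: poly_mapping_eqI simp: lookup_single when_def)

lemma chain_scale_sum: "chain_scale a (\<Sum>x\<in>A. f x) = (\<Sum>x\<in>A. chain_scale a (f x))"
  by (induction A rule: infinite_finite_induct) (auto simp: chain_scale_algebra)

lemma keys_chain_scale: "Poly_Mapping.keys (chain_scale a c) \<subseteq> Poly_Mapping.keys c"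
  by (auto simp: in_keys_iff)

lemma keys_sum: "Poly_Mapping.keys (\<Sum>x\<in>A. f x) \<subseteq> (\<Union>x\<in>A. Poly_Mapping.keys (f x))"
proof (induction A rule: infinite_finite_induct)
  case (insert x A)
  then show ?case
    using keys_add[of "f x" "sum f A"] by auto
qed auto

lemma keys_minus:
  fixes c c' :: "'x \<Rightarrow>\<^sub>0 'k::field"
  shows "Poly_Mapping.keys (c - c') \<subseteq> Poly_Mapping.keys c \<union> Poly_Mapping.keys c'"
  by (auto simp: in_keys_iff lookup_minus)

definition lin :: "('x \<Rightarrow> ('y \<Rightarrow>\<^sub>0 'k::field)) \<Rightarrow> ('x \<Rightarrow>\<^sub>0 'k) \<Rightarrow> ('y \<Rightarrow>\<^sub>0 'k)"
  where "lin f c = (\<Sum>x\<in>Poly_Mapping.keys c. chain_scale (Poly_Mapping.lookup c x) (f x))"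

lemma bdry_eq_lin: "bdry C n = lin (basis_bdry C n)"
  by (simp add: fun_eq_iff bdry_def lin_def)

lemma lin_superset:
  assumes "finite A" "Poly_Mapping.keys c \<subseteq> A"
  shows "lin f c = (\<Sum>x\<in>A. chain_scale (Poly_Mapping.lookup c x) (f x))"
  unfolding lin_def using assms
  by (intro sum.mono_neutral_left) (auto simp: in_keys_iff chain_scale_algebra)

lemma lin_zero [simp]: "lin f 0 = 0"
  by (simp add: lin_def)

lemma lin_single [simp]: "lin f (Poly_Mapping.single x a) = chain_scale a (f x)"
  by (subst lin_superset[of "{x}"]) auto

lemma lin_add: "lin f (c + c') = lin f c + lin f c'"
proof -
  let ?A = "Poly_Mapping.keys c \<union> Poly_Mapping.keys c'"
  have "lin f (c + c') = (\<Sum>x\<in>?A. chain_scale (Poly_Mapping.lookup (c + c') x) (f x))"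
    by (rule lin_superset) (auto dest: subsetD[OF keys_add])
  moreover have "lin f c = (\<Sum>x\<in>?A. chain_scale (Poly_Mapping.lookup c x) (f x))"
    and "lin f c' = (\<Sum>x\<in>?A. chain_scale (Poly_Mapping.lookup c' x) (f x))"
    by (auto intro!: lin_superset)
  ultimately show ?thesis
    by (simp add: lookup_add chain_scale_algebra sum.distrib)
qed

lemma lin_scale: "lin f (chain_scale a c) = chain_scale a (lin f c)"
  by (subst lin_superset[OF finite_keys keys_chain_scale])
    (simp add: lin_def chain_scale_sum chain_scale_algebra)

lemma lin_diff: "lin f (c - c') = lin f c - lin f c'"
  using lin_add[of f "c - c'" c'] by (simp add: algebra_simps)

lemma lin_sum: "lin f (\<Sum>i\<in>A. c i) = (\<Sum>i\<in>A. lin f (c i))"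
  by (induction A rule: infinite_finite_induct) (auto simp: lin_add)

lemma lin_lin: "lin f (lin g c) = lin (\<lambda>x. lin f (g x)) c"
  by (simp add: lin_def[of g] lin_def[of "\<lambda>x. lin f (g x)"] lin_sum lin_scale)

lemma lin_cong: "(\<And>x. x \<in> Poly_Mapping.keys c \<Longrightarrow> f x = g x) \<Longrightarrow> lin f c = lin g c"
  by (simp add: lin_def)

lemma lin_fun_diff: "lin (\<lambda>x. f x - g x) c = lin f c - lin g c"
  by (simp add: lin_def chain_scale_algebra sum_subtractf)

lemma lin_basis [simp]: "lin (\<lambda>x. Poly_Mapping.single x 1) c = c"
proof (rule poly_mapping_eqI)
  fix k
  show "Poly_Mapping.lookup (lin (\<lambda>x. Poly_Mapping.single x 1) c) k = Poly_Mapping.lookup c k"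
    by (cases "k \<in> Poly_Mapping.keys c")
      (auto simp: lin_def lookup_sum lookup_single when_def in_keys_iff sum.If_cases)
qed

lemma keys_lin: "Poly_Mapping.keys (lin f c) \<subseteq> (\<Union>x\<in>Poly_Mapping.keys c. Poly_Mapping.keys (f x))"
  using keys_sum keys_chain_scale unfolding lin_def by fastforce

text \<open>The sum of the coefficients, recorded as a chain on a one-element basis so that it is itself a
  linear extension and inherits every rule about \<^const>\<open>lin\<close>.\<close>

definition augmentation :: "('x \<Rightarrow>\<^sub>0 'k::field) \<Rightarrow> (unit \<Rightarrow>\<^sub>0 'k)"
  where "augmentation = lin (\<lambda>x. Poly_Mapping.single () 1)"

text \<open>A linear map that is constant on the basis factors through the augmentation. This handles the
  constant term of a cone operator in degree 0.\<close>

lemma lin_const: "lin (\<lambda>x. b) c = lin (\<lambda>u. b) (augmentation c)"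
  by (simp add: augmentation_def lin_lin chain_scale_algebra)

section \<open>Acyclic carriers\<close>

definition chains_in :: "('x, 'k::field) based_complex \<Rightarrow> ('x \<Rightarrow> 'v set) \<Rightarrow> nat \<Rightarrow> 'v set \<Rightarrow> ('x \<Rightarrow>\<^sub>0 'k) set"
  where "chains_in C s n \<sigma> = {c. \<forall>x\<in>Poly_Mapping.keys c. x \<in> basis C n \<and> s x \<subseteq> \<sigma>}"

lemma chains_in_mono: "c \<in> chains_in C s n \<sigma> \<Longrightarrow> \<sigma> \<subseteq> \<tau> \<Longrightarrow> c \<in> chains_in C s n \<tau>"
  by (auto simp: chains_in_def)

lemma chains_in_diff: "c \<in> chains_in C s n \<sigma> \<Longrightarrow> c' \<in> chains_in C s n \<sigma> \<Longrightarrow> c - c' \<in> chains_in C s n \<sigma>"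
  using keys_minus[of c c'] by (fastforce simp: chains_in_def)

lemma chains_in_single: "x \<in> basis C n \<Longrightarrow> s x \<subseteq> \<sigma> \<Longrightarrow> Poly_Mapping.single x a \<in> chains_in C s n \<sigma>"
  by (auto simp: chains_in_def)

lemma chains_in_sum: "(\<And>i. i \<in> A \<Longrightarrow> c i \<in> chains_in C s n \<sigma>) \<Longrightarrow> (\<Sum>i\<in>A. c i) \<in> chains_in C s n \<sigma>"
  using keys_sum[of c A] unfolding chains_in_def by blast

lemma chains_in_lin:
  assumes "c \<in> chains_in C s n \<sigma>"
    and "\<And>x. x \<in> basis C n \<Longrightarrow> s x \<subseteq> \<sigma> \<Longrightarrow> f x \<in> chains_in D t m \<tau>"
  shows "lin f c \<in> chains_in D t m \<tau>"
  using assms keys_lin[of f c] unfolding chains_in_def by blast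

text \<open>Coning off the simplices carried by \<open>\<sigma>\<close> with a vertex of \<open>\<sigma>\<close>. The requirements say that \<open>h\<close> contracts
  the chains carried by \<open>\<sigma>\<close>: \<open>\<partial>h + h\<partial>\<close> is the identity in positive degrees, and in degree 0 it is the
  identity minus a fixed 0-chain \<open>b\<close> of augmentation 1, namely the apex.\<close>

definition cone_operator ::
    "('x, 'k::field) based_complex \<Rightarrow> ('x \<Rightarrow> 'v set) \<Rightarrow> 'v set \<Rightarrow> ('x \<Rightarrow> ('x \<Rightarrow>\<^sub>0 'k)) \<Rightarrow> bool"
  where "cone_operator C s \<sigma> h \<longleftrightarrow>
    (\<forall>n. \<forall>x\<in>basis C n. s x \<subseteq> \<sigma> \<longrightarrow> h x \<in> chains_in C s (Suc n) \<sigma>) \<and>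
    (\<forall>n. \<forall>x\<in>basis C (Suc n). s x \<subseteq> \<sigma> \<longrightarrow>
       bdry C (Suc (Suc n)) (h x) = Poly_Mapping.single x 1 - lin h (basis_bdry C (Suc n) x)) \<and>
    (\<exists>b\<in>chains_in C s 0 \<sigma>. augmentation b = Poly_Mapping.single () 1 \<and>
       (\<forall>x\<in>basis C 0. s x \<subseteq> \<sigma> \<longrightarrow> bdry C (Suc 0) (h x) = Poly_Mapping.single x 1 - b))"

text \<open>The members of \<open>S\<close> serve as carriers, and the chains in each carrier can be coned off.
  The last assumption, that every basis element of positive degree is itself a cone, replaces a verification that the boundary squares to zero: cancelling signs is needed only
  once, in the formula for the boundary of a cone.\<close>

locale coned_complex =
  fixes C :: "('x, 'k::field) based_complex" and s :: "'x \<Rightarrow> 'v set" and S :: "'v set set"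
  assumes supp_in: "x \<in> basis C n \<Longrightarrow> s x \<in> S"
    and bdry_supp: "x \<in> basis C (Suc n) \<Longrightarrow> basis_bdry C (Suc n) x \<in> chains_in C s n (s x)"
    and aug_bdry: "x \<in> basis C (Suc 0) \<Longrightarrow> augmentation (basis_bdry C (Suc 0) x) = 0"
    and cone_ex: "\<sigma> \<in> S \<Longrightarrow> \<exists>h. cone_operator C s \<sigma> h"
    and is_cone: "x \<in> basis C (Suc n) \<Longrightarrow>
      \<exists>h y. cone_operator C s (s x) h \<and> y \<in> basis C n \<and> s y \<subseteq> s x \<and> h y = Poly_Mapping.single x 1"
begin

lemma cone_chain:
  assumes h: "cone_operator C s \<sigma> h" and c: "c \<in> chains_in C s (Suc n) \<sigma>"
  shows "bdry C (Suc (Suc n)) (lin h c) = c - lin h (bdry C (Suc n) c)"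
proof -
  have "bdry C (Suc (Suc n)) (lin h c) = lin (\<lambda>x. bdry C (Suc (Suc n)) (h x)) c"
    by (simp add: bdry_eq_lin lin_lin)
  also have "\<dots> = lin (\<lambda>x. Poly_Mapping.single x 1 - lin h (basis_bdry C (Suc n) x)) c"
    using h c by (intro lin_cong) (auto simp: cone_operator_def chains_in_def)
  finally show ?thesis
    by (simp add: lin_fun_diff lin_lin bdry_eq_lin)
qed

lemma cone_chain_0:
  assumes h: "cone_operator C s \<sigma> h" and c: "c \<in> chains_in C s 0 \<sigma>" and "augmentation c = 0"
  shows "bdry C (Suc 0) (lin h c) = c"
proof -
  obtain b where b: "\<forall>x\<in>basis C 0. s x \<subseteq> \<sigma> \<longrightarrow> bdry C (Suc 0) (h x) = Poly_Mapping.single x 1 - b"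
    using h by (auto simp: cone_operator_def)
  have "bdry C (Suc 0) (lin h c) = lin (\<lambda>x. bdry C (Suc 0) (h x)) c"
    by (simp add: bdry_eq_lin lin_lin)
  also have "\<dots> = lin (\<lambda>x. Poly_Mapping.single x 1 - b) c"
    using b c by (intro lin_cong) (auto simp: chains_in_def)
  also have "\<dots> = c"
    using lin_const[of b c] \<open>augmentation c = 0\<close> by (simp add: lin_fun_diff)
  finally show ?thesis .
qed

text \<open>For a cone \<open>x = h y\<close> one has \<open>\<partial>x = y - h(\<partial>y)\<close>, hence \<open>\<partial>\<partial>x = \<partial>y - \<partial>h(\<partial>y) = h(\<partial>\<partial>y)\<close>, which vanishes by
  induction on the degree. In the lowest degree the induction hypothesis is replaced by the vanishing
  of the augmentation of \<open>\<partial>y\<close>.\<close>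

lemma bdry_bdry_basis:
  "x \<in> basis C (Suc (Suc n)) \<Longrightarrow> bdry C (Suc n) (basis_bdry C (Suc (Suc n)) x) = 0"
proof (induction n arbitrary: x)
  case n: (0 x)
  then obtain h y where h: "cone_operator C s (s x) h" and y: "y \<in> basis C (Suc 0)" "s y \<subseteq> s x"
    and hy: "h y = Poly_Mapping.single x 1"
    using is_cone by blast
  have dy: "basis_bdry C (Suc 0) y \<in> chains_in C s 0 (s x)"
    using y bdry_supp chains_in_mono by blast
  have "basis_bdry C (Suc (Suc 0)) x = bdry C (Suc (Suc 0)) (h y)"
    by (simp add: hy bdry_eq_lin chain_scale_algebra)
  also have "\<dots> = Poly_Mapping.single y 1 - lin h (basis_bdry C (Suc 0) y)"
    using h y by (auto simp: cone_operator_def)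
  finally show ?case
    using cone_chain_0[OF h dy aug_bdry[OF y(1)]]
    by (simp add: bdry_eq_lin lin_diff chain_scale_algebra)
next
  case (Suc n)
  then obtain h y where h: "cone_operator C s (s x) h" and y: "y \<in> basis C (Suc (Suc n))" "s y \<subseteq> s x"
    and hy: "h y = Poly_Mapping.single x 1"
    using is_cone by blast
  have dy: "basis_bdry C (Suc (Suc n)) y \<in> chains_in C s (Suc n) (s x)"
    using y bdry_supp chains_in_mono by blast
  have "basis_bdry C (Suc (Suc (Suc n))) x = bdry C (Suc (Suc (Suc n))) (h y)"
    by (simp add: hy bdry_eq_lin chain_scale_algebra)
  also have "\<dots> = Poly_Mapping.single y 1 - lin h (basis_bdry C (Suc (Suc n)) y)"
    using h y by (auto simp: cone_operator_def)
  finally show ?case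
    using cone_chain[OF h dy] Suc.IH[OF y(1)]
    by (simp add: bdry_eq_lin lin_diff chain_scale_algebra)
qed

lemma acyclic:
  assumes "\<sigma> \<in> S" "c \<in> chains_in C s (Suc n) \<sigma>" "bdry C (Suc n) c = 0"
  shows "\<exists>e\<in>chains_in C s (Suc (Suc n)) \<sigma>. bdry C (Suc (Suc n)) e = c"
proof -
  obtain h where h: "cone_operator C s \<sigma> h"
    using cone_ex assms by blast
  then have "lin h c \<in> chains_in C s (Suc (Suc n)) \<sigma>"
    using assms by (intro chains_in_lin[OF assms(2)]) (auto simp: cone_operator_def)
  then show ?thesis
    using cone_chain[OF h assms(2)] assms(3) by auto
qed

lemma acyclic_0:
  assumes "\<sigma> \<in> S" "c \<in> chains_in C s 0 \<sigma>" "augmentation c = 0"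
  shows "\<exists>e\<in>chains_in C s (Suc 0) \<sigma>. bdry C (Suc 0) e = c"
proof -
  obtain h where h: "cone_operator C s \<sigma> h"
    using cone_ex assms by blast
  then have "lin h c \<in> chains_in C s (Suc 0) \<sigma>"
    using assms by (intro chains_in_lin[OF assms(2)]) (auto simp: cone_operator_def)
  then show ?thesis
    using cone_chain_0[OF h assms(2,3)] by auto
qed

lemma ex_vertex: "\<sigma> \<in> S \<Longrightarrow> \<exists>b\<in>chains_in C s 0 \<sigma>. augmentation b = Poly_Mapping.single () 1"
  using cone_ex unfolding cone_operator_def by blast

end

text \<open>Since no basis element leaves its own support, a carried map restricts to every subcomplex that
  is cut out by a condition on supports, and these restrictions are compatible with inclusions.\<close>

definition carried_map ::
    "('x, 'k::field) based_complex \<Rightarrow> ('x \<Rightarrow> 'v set) \<Rightarrow> ('y, 'k) based_complex \<Rightarrow> ('y \<Rightarrow> 'v set) \<Rightarrow>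
     (nat \<Rightarrow> 'x \<Rightarrow> ('y \<Rightarrow>\<^sub>0 'k)) \<Rightarrow> bool"
  where "carried_map C s D t f \<longleftrightarrow>
    (\<forall>n. \<forall>x\<in>basis C n. f n x \<in> chains_in D t n (s x)) \<and>
    (\<forall>x\<in>basis C 0. augmentation (f 0 x) = Poly_Mapping.single () 1) \<and>
    (\<forall>n. \<forall>x\<in>basis C (Suc n). bdry D (Suc n) (f (Suc n) x) = lin (f n) (basis_bdry C (Suc n) x))"

lemma carried_map_chain:
  assumes f: "carried_map C s D t f" and c: "c \<in> chains_in C s n \<sigma>"
  shows "lin (f n) c \<in> chains_in D t n \<sigma>"
  using f by (intro chains_in_lin[OF c]) (auto simp: carried_map_def intro: chains_in_mono)

lemma carried_map_aug:
  assumes f: "carried_map C s D t f" and c: "c \<in> chains_in C s 0 \<sigma>"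
  shows "augmentation (lin (f 0) c) = augmentation c"
proof -
  have "augmentation (lin (f 0) c) = lin (\<lambda>x. augmentation (f 0 x)) c"
    by (simp add: augmentation_def lin_lin)
  also have "\<dots> = lin (\<lambda>x. Poly_Mapping.single () 1) c"
    using f c by (intro lin_cong) (auto simp: carried_map_def chains_in_def)
  finally show ?thesis by (simp add: augmentation_def)
qed

lemma carried_map_bdry:
  assumes f: "carried_map C s D t f" and c: "c \<in> chains_in C s (Suc n) \<sigma>"
  shows "bdry D (Suc n) (lin (f (Suc n)) c) = lin (f n) (bdry C (Suc n) c)"
proof -
  have "bdry D (Suc n) (lin (f (Suc n)) c) = lin (\<lambda>x. bdry D (Suc n) (f (Suc n) x)) c"
    by (simp add: bdry_eq_lin lin_lin)
  also have "\<dots> = lin (\<lambda>x. lin (f n) (basis_bdry C (Suc n) x)) c"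
    using f c by (intro lin_cong) (auto simp: carried_map_def chains_in_def)
  finally show ?thesis by (simp add: bdry_eq_lin lin_lin)
qed

lemma carried_map_id: "carried_map C s C s (\<lambda>n x. Poly_Mapping.single x 1)"
  by (auto simp: carried_map_def chains_in_single augmentation_def bdry_eq_lin chain_scale_algebra)

text \<open>Supports do not grow under either map, hence not under the composite. Applied to maps from \<open>C\<close> to
  \<open>D\<close> and back, this allows a comparison with the identity by a carried homotopy.\<close>

lemma carried_map_comp:
  assumes f: "carried_map C s D t f" and g: "carried_map D t E u g"
    and bdry_supp: "\<And>n x. x \<in> basis C (Suc n) \<Longrightarrow> basis_bdry C (Suc n) x \<in> chains_in C s n (s x)"
  shows "carried_map C s E u (\<lambda>n x. lin (g n) (f n x))"
proof -
  have fx: "f n x \<in> chains_in D t n (s x)" if "x \<in> basis C n" for n x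
    using f that by (auto simp: carried_map_def)
  show ?thesis
    unfolding carried_map_def
  proof (intro conjI allI ballI)
    show "lin (g n) (f n x) \<in> chains_in E u n (s x)" if "x \<in> basis C n" for n x
      using carried_map_chain[OF g fx[OF that]] .
    show "augmentation (lin (g 0) (f 0 x)) = Poly_Mapping.single () 1" if "x \<in> basis C 0" for x
      using carried_map_aug[OF g fx[OF that]] f that by (simp add: carried_map_def)
    show "bdry E (Suc n) (lin (g (Suc n)) (f (Suc n) x))
        = lin (\<lambda>x. lin (g n) (f n x)) (basis_bdry C (Suc n) x)" if "x \<in> basis C (Suc n)" for n x
      using carried_map_bdry[OF g fx[OF that]] f that by (simp add: carried_map_def lin_lin)
  qed
qed

text \<open>The method of acyclic carriers: \<open>f\<close> is constructed degree by degree. If \<open>f\<close> is known in degree \<open>n\<close>,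
  then \<open>f(\<partial>x)\<close> is a cycle carried by the support of \<open>x\<close>, and any chain there that it bounds
  may serve as \<open>f x\<close>.\<close>

lemma ex_carried_map:
  fixes C :: "('x, 'k::field) based_complex" and D :: "('y, 'k) based_complex"
  assumes "coned_complex C s S" "coned_complex D t S"
  shows "\<exists>f. carried_map C s D t f"
proof -
  interpret C: coned_complex C s S by fact
  interpret D: coned_complex D t S by fact
  define f where "f = rec_nat
    (\<lambda>x. SOME c. c \<in> chains_in D t 0 (s x) \<and> augmentation c = Poly_Mapping.single () 1)
    (\<lambda>n g x. SOME c. c \<in> chains_in D t (Suc n) (s x) \<and>
       bdry D (Suc n) c = lin g (basis_bdry C (Suc n) x))"
  have f0: "f 0 x \<in> chains_in D t 0 (s x) \<and> augmentation (f 0 x) = Poly_Mapping.single () 1"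
    if "x \<in> basis C 0" for x
    using someI_ex[OF D.ex_vertex[OF C.supp_in[OF that], unfolded Bex_def]] by (simp add: f_def)
  have f_Suc: "f (Suc n) x \<in> chains_in D t (Suc n) (s x) \<and>
      bdry D (Suc n) (f (Suc n) x) = lin (f n) (basis_bdry C (Suc n) x)"
    if "\<exists>c\<in>chains_in D t (Suc n) (s x). bdry D (Suc n) c = lin (f n) (basis_bdry C (Suc n) x)" for n x
    using someI_ex[OF that[unfolded Bex_def]] by (simp add: f_def)
  have step: "f (Suc n) x \<in> chains_in D t (Suc n) (s x) \<and>
      bdry D (Suc n) (f (Suc n) x) = lin (f n) (basis_bdry C (Suc n) x)"
    if x: "x \<in> basis C (Suc n)" for n x
    using x
  proof (induction n arbitrary: x)
    case (0 x)
    let ?c = "basis_bdry C (Suc 0) x"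
    have c: "?c \<in> chains_in C s 0 (s x)"
      using C.bdry_supp[OF 0] .
    have "augmentation (lin (f 0) ?c) = lin (\<lambda>x. augmentation (f 0 x)) ?c"
      by (simp add: augmentation_def lin_lin)
    also have "\<dots> = augmentation ?c"
      unfolding augmentation_def using c f0
      by (intro lin_cong) (auto simp: chains_in_def augmentation_def)
    also have "\<dots> = 0"
      using C.aug_bdry[OF 0] .
    finally have "augmentation (lin (f 0) ?c) = 0" .
    moreover have "lin (f 0) ?c \<in> chains_in D t 0 (s x)"
      using f0 by (intro chains_in_lin[OF c]) (blast intro: chains_in_mono)
    ultimately show ?case
      using D.acyclic_0[OF C.supp_in[OF 0]] by (intro f_Suc) blast
  next
    case (Suc n x)
    let ?c = "basis_bdry C (Suc (Suc n)) x"
    have c: "?c \<in> chains_in C s (Suc n) (s x)"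
      using C.bdry_supp[OF Suc.prems] .
    have "bdry D (Suc n) (lin (f (Suc n)) ?c) = lin (\<lambda>x. bdry D (Suc n) (f (Suc n) x)) ?c"
      by (simp add: bdry_eq_lin lin_lin)
    also have "\<dots> = lin (\<lambda>x. lin (f n) (basis_bdry C (Suc n) x)) ?c"
      using c Suc.IH by (intro lin_cong) (auto simp: chains_in_def)
    also have "\<dots> = lin (f n) (bdry C (Suc n) ?c)"
      by (simp add: bdry_eq_lin lin_lin)
    also have "\<dots> = 0"
      using C.bdry_bdry_basis[OF Suc.prems] by simp
    finally have "bdry D (Suc n) (lin (f (Suc n)) ?c) = 0" .
    moreover have "lin (f (Suc n)) ?c \<in> chains_in D t (Suc n) (s x)"
      using Suc.IH by (intro chains_in_lin[OF c]) (blast intro: chains_in_mono)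
    ultimately show ?case
      using D.acyclic[OF C.supp_in[OF Suc.prems]] by (intro f_Suc) blast
  qed
  have "f n x \<in> chains_in D t n (s x)" if "x \<in> basis C n" for n x
    using that f0 step by (cases n) auto
  then show ?thesis
    using f0 step unfolding carried_map_def by blast
qed

definition carried_homotopy ::
    "('x, 'k::field) based_complex \<Rightarrow> ('x \<Rightarrow> 'v set) \<Rightarrow> ('y, 'k) based_complex \<Rightarrow> ('y \<Rightarrow> 'v set) \<Rightarrow>
     (nat \<Rightarrow> 'x \<Rightarrow> ('y \<Rightarrow>\<^sub>0 'k)) \<Rightarrow> (nat \<Rightarrow> 'x \<Rightarrow> ('y \<Rightarrow>\<^sub>0 'k)) \<Rightarrow> (nat \<Rightarrow> 'x \<Rightarrow> ('y \<Rightarrow>\<^sub>0 'k)) \<Rightarrow> bool"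
  where "carried_homotopy C s D t f g T \<longleftrightarrow>
    (\<forall>n. \<forall>x\<in>basis C n. T n x \<in> chains_in D t (Suc n) (s x)) \<and>
    (\<forall>x\<in>basis C 0. bdry D (Suc 0) (T 0 x) = f 0 x - g 0 x) \<and>
    (\<forall>n. \<forall>x\<in>basis C (Suc n). bdry D (Suc (Suc n)) (T (Suc n) x) =
       f (Suc n) x - g (Suc n) x - lin (T n) (basis_bdry C (Suc n) x))"

text \<open>The same construction one degree higher: \<open>f x - g x - T(\<partial>x)\<close> is a cycle carried by the support
  of \<open>x\<close>, so it bounds there. In degree 0 it is the equality of augmentations that makes
  \<open>f x - g x\<close> a boundary.\<close>

lemma ex_carried_homotopy:
  fixes C :: "('x, 'k::field) based_complex" and D :: "('y, 'k) based_complex"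
  assumes "coned_complex C s S" "coned_complex D t S"
    and f: "carried_map C s D t f" and g: "carried_map C s D t g"
  shows "\<exists>T. carried_homotopy C s D t f g T"
proof -
  interpret C: coned_complex C s S by fact
  interpret D: coned_complex D t S by fact
  have fx: "f n x \<in> chains_in D t n (s x)" and gx: "g n x \<in> chains_in D t n (s x)"
    if "x \<in> basis C n" for n x
    using f g that by (auto simp: carried_map_def)
  define T where "T = rec_nat
    (\<lambda>x. SOME c. c \<in> chains_in D t (Suc 0) (s x) \<and> bdry D (Suc 0) c = f 0 x - g 0 x)
    (\<lambda>n T x. SOME c. c \<in> chains_in D t (Suc (Suc n)) (s x) \<and>
       bdry D (Suc (Suc n)) c = f (Suc n) x - g (Suc n) x - lin T (basis_bdry C (Suc n) x))"
  have T0: "T 0 x \<in> chains_in D t (Suc 0) (s x) \<and> bdry D (Suc 0) (T 0 x) = f 0 x - g 0 x"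
    if x: "x \<in> basis C 0" for x
  proof -
    have "augmentation (f 0 x - g 0 x) = 0"
      using f g x by (simp add: carried_map_def augmentation_def lin_diff)
    then have "\<exists>c\<in>chains_in D t (Suc 0) (s x). bdry D (Suc 0) c = f 0 x - g 0 x"
      using D.acyclic_0[OF C.supp_in[OF x]] chains_in_diff[OF fx[OF x] gx[OF x]] by blast
    from someI_ex[OF this[unfolded Bex_def]] show ?thesis
      by (simp add: T_def)
  qed
  have T_Suc: "T (Suc n) x \<in> chains_in D t (Suc (Suc n)) (s x) \<and> bdry D (Suc (Suc n)) (T (Suc n) x)
      = f (Suc n) x - g (Suc n) x - lin (T n) (basis_bdry C (Suc n) x)"
    if x: "x \<in> basis C (Suc n)"
      and T: "\<And>y. y \<in> basis C n \<Longrightarrow> T n y \<in> chains_in D t (Suc n) (s y)"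
      and bT: "bdry D (Suc n) (lin (T n) (basis_bdry C (Suc n) x))
        = lin (f n) (basis_bdry C (Suc n) x) - lin (g n) (basis_bdry C (Suc n) x)" for n x
  proof -
    let ?c = "f (Suc n) x - g (Suc n) x - lin (T n) (basis_bdry C (Suc n) x)"
    have "lin (T n) (basis_bdry C (Suc n) x) \<in> chains_in D t (Suc n) (s x)"
      using T by (intro chains_in_lin[OF C.bdry_supp[OF x]]) (blast intro: chains_in_mono)
    then have "?c \<in> chains_in D t (Suc n) (s x)"
      by (intro chains_in_diff fx gx x)
    moreover have "bdry D (Suc n) ?c = 0"
      using bT f g x by (simp add: bdry_eq_lin lin_diff carried_map_def)
    ultimately have "\<exists>c\<in>chains_in D t (Suc (Suc n)) (s x). bdry D (Suc (Suc n)) c = ?c"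
      using D.acyclic[OF C.supp_in[OF x]] by blast
    from someI_ex[OF this[unfolded Bex_def]] show ?thesis
      by (simp add: T_def)
  qed
  have step: "T (Suc n) x \<in> chains_in D t (Suc (Suc n)) (s x) \<and> bdry D (Suc (Suc n)) (T (Suc n) x)
      = f (Suc n) x - g (Suc n) x - lin (T n) (basis_bdry C (Suc n) x)"
    if "x \<in> basis C (Suc n)" for n x
    using that
  proof (induction n arbitrary: x)
    case (0 x)
    let ?c = "basis_bdry C (Suc 0) x"
    have c: "?c \<in> chains_in C s 0 (s x)"
      using C.bdry_supp[OF 0] .
    have "bdry D (Suc 0) (lin (T 0) ?c) = lin (\<lambda>x. bdry D (Suc 0) (T 0 x)) ?c"
      by (simp add: bdry_eq_lin lin_lin)
    also have "\<dots> = lin (\<lambda>x. f 0 x - g 0 x) ?c"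
      using c T0 by (intro lin_cong) (auto simp: chains_in_def)
    finally show ?case
      using T0 by (intro T_Suc 0) (auto simp: lin_fun_diff)
  next
    case (Suc n x)
    let ?c = "basis_bdry C (Suc (Suc n)) x"
    have c: "?c \<in> chains_in C s (Suc n) (s x)"
      using C.bdry_supp[OF Suc.prems] .
    have "bdry D (Suc (Suc n)) (lin (T (Suc n)) ?c) = lin (\<lambda>x. bdry D (Suc (Suc n)) (T (Suc n) x)) ?c"
      by (simp add: bdry_eq_lin lin_lin)
    also have "\<dots> = lin (\<lambda>x. f (Suc n) x - g (Suc n) x - lin (T n) (basis_bdry C (Suc n) x)) ?c"
      using c Suc.IH by (intro lin_cong) (auto simp: chains_in_def)
    also have "\<dots> = lin (f (Suc n)) ?c - lin (g (Suc n)) ?c - lin (T n) (bdry C (Suc n) ?c)"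
      by (simp add: lin_fun_diff bdry_eq_lin lin_lin)
    finally show ?case
      using Suc.IH C.bdry_bdry_basis[OF Suc.prems] by (intro T_Suc Suc.prems) auto
  qed
  have "T n x \<in> chains_in D t (Suc n) (s x)" if "x \<in> basis C n" for n x
    using that T0 step by (cases n) auto
  then show ?thesis
    using T0 step unfolding carried_homotopy_def by blast
qed

section \<open>Induced isomorphisms on persistent homology\<close>

definition chain_subspace :: "('x \<Rightarrow>\<^sub>0 'k::field) set \<Rightarrow> bool"
  where "chain_subspace B \<longleftrightarrow> 0 \<in> B \<and> (\<forall>x\<in>B. \<forall>y\<in>B. x + y \<in> B) \<and> (\<forall>a. \<forall>x\<in>B. chain_scale a x \<in> B)"

lemma chain_subspace_diff: "chain_subspace B \<Longrightarrow> x \<in> B \<Longrightarrow> y \<in> B \<Longrightarrow> x - y \<in> B"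
proof -
  assume B: "chain_subspace B" "x \<in> B" "y \<in> B"
  then have "x + chain_scale (-1) y \<in> B"
    by (simp add: chain_subspace_def)
  then show ?thesis
    by (simp add: chain_scale_minus chain_scale_algebra)
qed

lemma chain_subspace_boundaries: "chain_subspace (based_boundaries C n)"
proof -
  let ?B = "based_boundaries C n"
  have "0 \<in> ?B"
    using imageI[of 0 "based_chains C (Suc n)" "bdry C (Suc n)"]
    by (simp add: based_boundaries_def based_chains_def bdry_eq_lin)
  moreover have "bdry C (Suc n) c + bdry C (Suc n) c' \<in> ?B"
    if "c \<in> based_chains C (Suc n)" "c' \<in> based_chains C (Suc n)" for c c'
    using that keys_add[of c c']
      imageI[of "c + c'" "based_chains C (Suc n)" "bdry C (Suc n)"]
    by (auto simp: based_boundaries_def based_chains_def bdry_eq_lin lin_add)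
  moreover have "chain_scale a (bdry C (Suc n) c) \<in> ?B" if "c \<in> based_chains C (Suc n)" for a c
    using that keys_chain_scale[of a c]
      imageI[of "chain_scale a c" "based_chains C (Suc n)" "bdry C (Suc n)"]
    by (auto simp: based_boundaries_def based_chains_def bdry_eq_lin lin_scale)
  ultimately show ?thesis
    by (auto simp: chain_subspace_def based_boundaries_def)
qed

lemma coset_eqD: "chain_subspace B \<Longrightarrow> z +o B = z' +o B \<Longrightarrow> z - z' \<in> B"
proof -
  assume B: "chain_subspace B" and eq: "z +o B = z' +o B"
  have "z + 0 \<in> z +o B"
    using B by (intro set_plus_intro2) (simp add: chain_subspace_def)
  then obtain b where "b \<in> B" "z = z' + b"
    unfolding eq by (auto simp: elt_set_plus_def)
  then show ?thesis by simp
qed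

lemma coset_eqI: "chain_subspace B \<Longrightarrow> z - z' \<in> B \<Longrightarrow> z +o B = z' +o B"
proof -
  have sub: "z +o B \<subseteq> z' +o B" if B: "chain_subspace B" "z - z' \<in> B" for z z'
  proof
    fix x assume "x \<in> z +o B"
    then obtain b where "b \<in> B" "x = z + b"
      by (auto simp: elt_set_plus_def)
    then show "x \<in> z' +o B"
      using B by (auto simp: elt_set_plus_def chain_subspace_def intro!: bexI[of _ "(z - z') + b"])
  qed
  assume B: "chain_subspace B" "z - z' \<in> B"
  then have "z' - z \<in> B"
    using chain_subspace_diff[of B 0 "z - z'"] by (simp add: chain_subspace_def)
  with B sub show ?thesis by blast
qed

text \<open>One computation serves three operations on cosets: the map on homology (\<open>f\<close> a chain map), the map
  induced by an inclusion (\<open>f\<close> the identity) and scalar multiplication (\<open>f\<close> scaling by a constant).\<close>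

lemma coset_image:
  assumes add: "\<And>x y. f (x + y) = f x + f y" and "f ` B \<subseteq> B'"
    and "chain_subspace B" "chain_subspace B'"
  shows "f ` (z +o B) + B' = f z +o B'"
proof (intro equalityI subsetI)
  fix x assume "x \<in> f ` (z +o B) + B'"
  then obtain b b' where "b \<in> B" "b' \<in> B'" "x = f z + (f b + b')"
    by (auto simp: elt_set_plus_def set_plus_def add add.assoc)
  moreover have "f b + b' \<in> B'"
    using assms \<open>b \<in> B\<close> \<open>b' \<in> B'\<close> by (auto simp: chain_subspace_def)
  ultimately show "x \<in> f z +o B'"
    by (auto simp: elt_set_plus_def)
next
  fix x assume "x \<in> f z +o B'"
  then obtain b' where b': "b' \<in> B'" "x = f z + b'"
    by (auto simp: elt_set_plus_def)
  have "z + 0 \<in> z +o B"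
    using assms by (intro set_plus_intro2) (simp add: chain_subspace_def)
  then show "x \<in> f ` (z +o B) + B'"
    using b' by (auto simp: set_plus_def)
qed

lemma coset_add:
  assumes "chain_subspace B"
  shows "(z +o B) + (z' +o B) = (z + z') +o B"
proof -
  have "B + B = B"
    using coset_image[of "\<lambda>x. x" B B 0] assms by simp
  then show ?thesis
    by (simp add: set_plus_rearrange)
qed

definition homology_map ::
    "(('x \<Rightarrow>\<^sub>0 'k::field) \<Rightarrow> ('y \<Rightarrow>\<^sub>0 'k)) \<Rightarrow> ('y, 'k) based_complex \<Rightarrow> nat \<Rightarrow> ('x \<Rightarrow>\<^sub>0 'k) set \<Rightarrow> ('y \<Rightarrow>\<^sub>0 'k) set"
  where "homology_map f D n A = f ` A + based_boundaries D n"

lemma homology_map_coset: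
  assumes "\<And>x y. f (x + y) = f x + f y" "f ` based_boundaries C n \<subseteq> based_boundaries D n"
  shows "homology_map f D n (z +o based_boundaries C n) = f z +o based_boundaries D n"
  unfolding homology_map_def
  by (intro coset_image assms chain_subspace_boundaries)

lemma homology_incl_coset:
  assumes "based_boundaries C n \<subseteq> based_boundaries D n"
  shows "homology_incl D n (z +o based_boundaries C n) = z +o based_boundaries D n"
  using homology_map_coset[of "\<lambda>x. x" C n D] assms by (simp add: homology_incl_def homology_map_def)

text \<open>Injectivity comes from \<open>g \<circ> f\<close>, and surjectivity from \<open>f \<circ> g\<close>, being the identity on cycles up to
  boundaries.\<close>

lemma linear_iso_homology_map:
  fixes C :: "('x, 'k::field) based_complex" and D :: "('y, 'k) based_complex"
  assumes f_add: "\<And>x y. f (x + y) = f x + f y" and f_scale: "\<And>a x. f (chain_scale a x) = chain_scale a (f x)"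
    and f_cycles: "f ` based_cycles C n \<subseteq> based_cycles D n"
    and f_bdries: "f ` based_boundaries C n \<subseteq> based_boundaries D n"
    and g_diff: "\<And>x y. g (x - y) = g x - g y"
    and g_cycles: "g ` based_cycles D n \<subseteq> based_cycles C n"
    and g_bdries: "g ` based_boundaries D n \<subseteq> based_boundaries C n"
    and gf: "\<And>z. z \<in> based_cycles C n \<Longrightarrow> g (f z) - z \<in> based_boundaries C n"
    and fg: "\<And>z. z \<in> based_cycles D n \<Longrightarrow> f (g z) - z \<in> based_boundaries D n"
  shows "linear_iso (homology C n) (homology D n) (homology_map f D n)"
proof -
  let ?B = "based_boundaries C n" and ?B' = "based_boundaries D n"
  let ?h = "homology_map f D n"
  note B = chain_subspace_boundaries[of C n] and B' = chain_subspace_boundaries[of D n]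
  have h: "?h (z +o ?B) = f z +o ?B'" for z
    by (rule homology_map_coset[OF f_add f_bdries])
  have smult: "chain_scale a ` (z +o based_boundaries E n) + based_boundaries E n
      = chain_scale a z +o based_boundaries E n" for a z and E :: "('z, 'k) based_complex"
    using chain_subspace_boundaries[of E n]
    by (intro coset_image) (auto simp: chain_scale_algebra chain_subspace_def)
  have "inj_on ?h (carrier (homology C n))"
  proof (rule inj_onI)
    fix A A' assume "A \<in> carrier (homology C n)" "A' \<in> carrier (homology C n)" and eq: "?h A = ?h A'"
    then obtain z z' where z: "z \<in> based_cycles C n" "A = z +o ?B"
      and z': "z' \<in> based_cycles C n" "A' = z' +o ?B"
      by (auto simp: homology_def)
    have "f z - f z' \<in> ?B'"
      using coset_eqD[OF B'] eq by (simp add: z z' h)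
    then have "g (f z) - g (f z') \<in> ?B"
      using g_bdries by (auto simp flip: g_diff)
    \<comment> \<open>This difference equals \<open>z - z'\<close>, because the terms \<open>g (f z)\<close> and \<open>g (f z')\<close> cancel.\<close>
    then have "(g (f z) - g (f z')) - ((g (f z) - z) - (g (f z') - z')) \<in> ?B"
      by (rule chain_subspace_diff[OF B _ chain_subspace_diff[OF B gf[OF z(1)] gf[OF z'(1)]]])
    then show "A = A'"
      unfolding z z' by (intro coset_eqI[OF B]) simp
  qed
  moreover have "?h ` carrier (homology C n) = carrier (homology D n)"
  proof (intro equalityI subsetI)
    fix A assume "A \<in> ?h ` carrier (homology C n)"
    then obtain z where "z \<in> based_cycles C n" "A = f z +o ?B'"
      by (auto simp: homology_def h)
    then show "A \<in> carrier (homology D n)"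
      using f_cycles by (auto simp: homology_def)
  next
    fix A assume "A \<in> carrier (homology D n)"
    then obtain z where z: "z \<in> based_cycles D n" "A = z +o ?B'"
      by (auto simp: homology_def)
    have "?h (g z +o ?B) = A"
      unfolding h z by (intro coset_eqI[OF B'] fg z)
    moreover have "g z +o ?B \<in> carrier (homology C n)"
      using g_cycles z by (auto simp: homology_def)
    ultimately show "A \<in> ?h ` carrier (homology C n)" by blast
  qed
  ultimately show ?thesis
    unfolding linear_iso_def bij_betw_def
    by (auto simp: homology_def h smult coset_add[OF B] coset_add[OF B'] f_add f_scale)
qed

definition restrict_complex ::
    "('x, 'k::field) based_complex \<Rightarrow> ('x \<Rightarrow> 'v set) \<Rightarrow> 'v set set \<Rightarrow> ('x, 'k) based_complex"
  where "restrict_complex C s K = C\<lparr>basis := \<lambda>n. {x \<in> basis C n. s x \<in> K}\<rparr>"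

text \<open>The part \<open>K\<close> of the family \<open>S\<close> is closed under passing to smaller members of \<open>S\<close>, so that a chain
  carried by a member of \<open>K\<close> has all its supports in \<open>K\<close>.\<close>

definition subfamily :: "'v set set \<Rightarrow> 'v set set \<Rightarrow> bool"
  where "subfamily K S \<longleftrightarrow> K \<subseteq> S \<and> (\<forall>\<sigma>\<in>K. \<forall>\<tau>\<in>S. \<tau> \<subseteq> \<sigma> \<longrightarrow> \<tau> \<in> K)"

lemma bdry_restrict: "bdry (restrict_complex C s K) n = bdry C n"
  by (simp add: bdry_eq_lin restrict_complex_def)

lemma lin_restrict:
  assumes K: "subfamily K S" and D: "coned_complex D t S"
    and f: "\<And>x. x \<in> basis C n \<Longrightarrow> f x \<in> chains_in D t m (s x)"
    and c: "c \<in> based_chains (restrict_complex C s K) n"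
  shows "lin f c \<in> based_chains (restrict_complex D t K) m"
proof -
  interpret D: coned_complex D t S by fact
  show ?thesis
    unfolding based_chains_def
  proof (clarify)
    fix y assume "y \<in> Poly_Mapping.keys (lin f c)"
    then obtain x where "x \<in> Poly_Mapping.keys c" and y: "y \<in> Poly_Mapping.keys (f x)"
      using keys_lin[of f c] by blast
    then have x: "x \<in> basis C n" "s x \<in> K"
      using c by (auto simp: based_chains_def restrict_complex_def)
    then have "y \<in> basis D m" "t y \<subseteq> s x"
      using f[OF x(1)] y by (auto simp: chains_in_def)
    then show "y \<in> basis (restrict_complex D t K) m"
      using x K D.supp_in by (auto simp: restrict_complex_def subfamily_def)
  qed
qed

context
  fixes C :: "('x, 'k::field) based_complex" and s :: "'x \<Rightarrow> 'v set"
    and D :: "('y, 'k) based_complex" and t :: "'y \<Rightarrow> 'v set" and S :: "'v set set"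
  assumes C: "coned_complex C s S" and D: "coned_complex D t S"
begin

lemma chains_in_UNIV: "c \<in> based_chains (restrict_complex C s K) n \<Longrightarrow> c \<in> chains_in C s n UNIV"
  by (auto simp: based_chains_def restrict_complex_def chains_in_def)

lemma carried_map_cycles:
  assumes K: "subfamily K S" and f: "carried_map C s D t f"
  shows "lin (f n) ` based_cycles (restrict_complex C s K) n \<subseteq> based_cycles (restrict_complex D t K) n"
proof clarify
  fix z assume z: "z \<in> based_cycles (restrict_complex C s K) n"
  then have zc: "z \<in> based_chains (restrict_complex C s K) n"
    by (simp add: based_cycles_def)
  have "lin (f n) z \<in> based_chains (restrict_complex D t K) n"
    using f by (intro lin_restrict[OF K D _ zc]) (auto simp: carried_map_def)
  moreover have "n = 0 \<or> bdry D n (lin (f n) z) = 0"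
    using z carried_map_bdry[OF f, of z "n - 1"] chains_in_UNIV[OF zc]
    by (cases n) (auto simp: based_cycles_def bdry_restrict)
  ultimately show "lin (f n) z \<in> based_cycles (restrict_complex D t K) n"
    by (simp add: based_cycles_def bdry_restrict)
qed

lemma carried_map_boundaries:
  assumes K: "subfamily K S" and f: "carried_map C s D t f"
  shows "lin (f n) ` based_boundaries (restrict_complex C s K) n
    \<subseteq> based_boundaries (restrict_complex D t K) n"
proof -
  have "lin (f n) (bdry C (Suc n) c) \<in> based_boundaries (restrict_complex D t K) n"
    if c: "c \<in> based_chains (restrict_complex C s K) (Suc n)" for c
  proof -
    have "lin (f (Suc n)) c \<in> based_chains (restrict_complex D t K) (Suc n)"
      using f by (intro lin_restrict[OF K D _ c]) (auto simp: carried_map_def)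
    then show ?thesis
      using carried_map_bdry[OF f chains_in_UNIV[OF c]]
      by (metis based_boundaries_def bdry_restrict imageI)
  qed
  then show ?thesis
    by (auto simp: based_boundaries_def[of "restrict_complex C s K"] bdry_restrict)
qed

lemma carried_homotopy_boundaries:
  assumes K: "subfamily K S" and T: "carried_homotopy C s D t f g T"
    and z: "z \<in> based_cycles (restrict_complex C s K) n"
  shows "lin (f n) z - lin (g n) z \<in> based_boundaries (restrict_complex D t K) n"
proof -
  have zc: "z \<in> based_chains (restrict_complex C s K) n"
    using z by (simp add: based_cycles_def)
  then have zb: "x \<in> basis C n" if "x \<in> Poly_Mapping.keys z" for x
    using that by (auto simp: based_chains_def restrict_complex_def)
  have "bdry D (Suc n) (lin (T n) z) = lin (\<lambda>x. bdry D (Suc n) (T n x)) z"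
    by (simp add: bdry_eq_lin lin_lin)
  also have "\<dots> = lin (f n) z - lin (g n) z"
  proof (cases n)
    case 0
    then have "lin (\<lambda>x. bdry D (Suc n) (T n x)) z = lin (\<lambda>x. f n x - g n x) z"
      using T zb by (intro lin_cong) (auto simp: carried_homotopy_def)
    then show ?thesis by (simp add: lin_fun_diff)
  next
    case (Suc m)
    then have "lin (\<lambda>x. bdry D (Suc n) (T n x)) z
        = lin (\<lambda>x. f n x - g n x - lin (T m) (basis_bdry C n x)) z"
      using T zb by (intro lin_cong) (auto simp: carried_homotopy_def)
    moreover have "bdry C n z = 0"
      using z Suc by (simp add: based_cycles_def bdry_restrict)
    ultimately show ?thesis by (simp add: lin_fun_diff bdry_eq_lin flip: lin_lin)
  qed
  finally have "bdry D (Suc n) (lin (T n) z) = lin (f n) z - lin (g n) z" .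
  moreover have "lin (T n) z \<in> based_chains (restrict_complex D t K) (Suc n)"
    using T by (intro lin_restrict[OF K D _ zc]) (auto simp: carried_homotopy_def)
  ultimately show ?thesis
    by (metis based_boundaries_def bdry_restrict imageI)
qed

end

text \<open>Both \<open>g \<circ> f\<close> and the identity are carried maps from \<open>C\<close> to itself, hence homotopic by a
  carried homotopy, which stays inside the subcomplex given by \<open>K\<close>.\<close>

lemma carried_map_round_trip:
  assumes C: "coned_complex C s S" and D: "coned_complex D t S" and K: "subfamily K S"
    and f: "carried_map C s D t f" and g: "carried_map D t C s g"
    and z: "z \<in> based_cycles (restrict_complex C s K) n"
  shows "lin (g n) (lin (f n) z) - z \<in> based_boundaries (restrict_complex C s K) n"
proof -
  interpret C: coned_complex C s S by fact
  obtain T where "carried_homotopy C s C s (\<lambda>n x. lin (g n) (f n x)) (\<lambda>n x. Poly_Mapping.single x 1) T"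
    using ex_carried_homotopy[OF C C carried_map_comp[OF f g C.bdry_supp] carried_map_id] by blast
  from carried_homotopy_boundaries[OF C C K this z] show ?thesis
    by (simp add: lin_lin)
qed

text \<open>One pair of carried maps between the ambient complexes is restricted to all stages at once. Since
  the map on homology at every stage comes from the same map of chains, it commutes with the
  inclusions.\<close>

theorem coned_complexes_isomorphic:
  fixes C :: "('x, 'k::field) based_complex" and D :: "('y, 'k) based_complex"
    and K :: "'i::order \<Rightarrow> 'v set set"
  assumes C: "coned_complex C s S" and D: "coned_complex D t S"
    and K: "\<And>i. subfamily (K i) S" and mono: "\<And>i j. i \<le> j \<Longrightarrow> K i \<subseteq> K j"
  shows "isomorphic_persistence_modules
    (persistent_homology n (\<lambda>i. restrict_complex C s (K i)))
    (persistent_homology n (\<lambda>i. restrict_complex D t (K i)))"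
proof -
  obtain f g where f: "carried_map C s D t f" and g: "carried_map D t C s g"
    using ex_carried_map C D by metis
  let ?C = "\<lambda>i. restrict_complex C s (K i)" and ?D = "\<lambda>i. restrict_complex D t (K i)"
  have incl: "based_boundaries (restrict_complex E u (K i)) n
      \<subseteq> based_boundaries (restrict_complex E u (K j)) n"
    if "i \<le> j" for i j and E :: "('z, 'k) based_complex" and u
    using mono[OF that] unfolding based_boundaries_def bdry_restrict
    by (intro image_mono) (auto simp: based_chains_def restrict_complex_def)
  note h = homology_map_coset[OF lin_add carried_map_boundaries[OF C D K f]]
  show ?thesis
    unfolding isomorphic_persistence_modules_def persistent_homology_def fst_conv snd_conv
  proof (intro exI[of _ "\<lambda>i. homology_map (lin (f n)) (?D i) n"] conjI allI impI ballI)
    show "linear_iso (homology (?C i) n) (homology (?D i) n) (homology_map (lin (f n)) (?D i) n)" for i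
      by (rule linear_iso_homology_map[where g = "lin (g n)"])
        (rule lin_add lin_scale lin_diff
          carried_map_cycles[OF C D K f] carried_map_boundaries[OF C D K f]
          carried_map_cycles[OF D C K g] carried_map_boundaries[OF D C K g]
          carried_map_round_trip[OF C D K f g] carried_map_round_trip[OF D C K g f]
        | assumption)+
    fix i j and A assume "i \<le> j" and "A \<in> carrier (homology (?C i) n)"
    then obtain z where A: "A = z +o based_boundaries (?C i) n"
      by (auto simp: homology_def)
    show "homology_map (lin (f n)) (?D j) n (homology_incl (?C j) n A)
        = homology_incl (?D j) n (homology_map (lin (f n)) (?D i) n A)"
      unfolding A h by (simp add: homology_incl_coset incl[OF \<open>i \<le> j\<close>] h)
  qed
qed

section \<open>The monoidal Rips complex as tuples spanning a simplex\<close>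

definition tuple_sset :: "'v set set \<Rightarrow> 'v list sset"
  where "tuple_sset K = \<lparr>simp = (\<lambda>n. {y. length y = Suc n \<and> set y \<in> K}), pull = (\<lambda>m n. reindex m)\<rparr>"

lemma length_reindex [simp]: "length (reindex m \<alpha> y) = Suc m"
  by (simp add: reindex_def)

lemma nth_reindex: "i \<le> m \<Longrightarrow> reindex m \<alpha> y ! i = y ! \<alpha> i"
  by (simp add: reindex_def del: upt_Suc)

lemma set_reindex_subset:
  "(\<And>i. i \<le> m \<Longrightarrow> \<alpha> i < length y) \<Longrightarrow> set (reindex m \<alpha> y) \<subseteq> set y"
  by (auto simp: reindex_def simp del: upt_Suc)

lemma foldr_sup_le_iff:
  fixes b :: "'l::semilattice_sup"
  shows "foldr sup xs a \<le> b \<longleftrightarrow> a \<le> b \<and> (\<forall>x\<in>set xs. x \<le> b)"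
  by (induction xs) auto

lemma monoidal_length_sup_le:
  fixes G :: "'v \<Rightarrow> 'v \<Rightarrow> 'l::semilattice_sup"
  assumes "e \<le> p" "y \<noteq> []" "\<And>v w. v \<in> set y \<Longrightarrow> w \<in> set y \<Longrightarrow> G v w \<le> p"
  shows "monoidal_length sup e G y \<le> p"
  using assms by (auto simp: monoidal_length_def foldr_sup_le_iff)

text \<open>Restricting a tuple along a constant map tests \<open>\<gamma>\<close> at one entry, since \<open>d\<close> vanishes on the diagonal,
  and restricting it to two indices \<open>i < j\<close> with distinct entries tests the distance of these entries;
  symmetry of \<open>d\<close> removes the dependence on the order. Conversely a supremum is at most \<open>p\<close> as soon as all its
  terms are, so no longer restriction gives a further condition. This is the only place where the
  particular form of the graph enters.\<close>

lemma sublevel_monoidal_rips_eq_tuple_sset: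
  assumes d: "extended_metric_on V d"
  shows "sublevel_monoidal_rips V d \<gamma> p = tuple_sset (sublevel_rips V d \<gamma> p)"
proof -
  obtain t s where p: "p = (t, s)" by fastforce
  let ?G = "sublevel_graph d \<gamma>" and ?L = "monoidal_length sup (0, 0) (sublevel_graph d \<gamma>)"
  have "set y \<subseteq> V \<and> (\<forall>m. \<forall>\<alpha>\<in>simplex_maps m n. ?L (reindex m \<alpha> y) \<le> p)
      \<longleftrightarrow> set y \<in> sublevel_rips V d \<gamma> p" (is "?A \<longleftrightarrow> ?B") if len: "length y = Suc n" for n y
  proof
    assume A: ?A
    have \<gamma>: "\<gamma> (y ! i) \<le> s" if "i \<le> n" for i
    proof -
      have "(\<lambda>_. i) \<in> simplex_maps 0 n"
        using that by (auto simp: simplex_maps_def mono_on_def)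
      moreover have "reindex 0 (\<lambda>_. i) y = [y ! i]"
        by (simp add: reindex_def)
      ultimately have "?L [y ! i] \<le> p"
        using A by metis
      then show ?thesis
        by (simp add: monoidal_length_def sublevel_graph_def p)
    qed
    have le: "d (y ! i) (y ! j) \<le> t" if "i \<le> j" "j \<le> n" for i j
    proof (cases "y ! i = y ! j")
      case True
      have "y ! i \<in> V"
        using A len that by (auto simp: subset_iff)
      then have "d (y ! i) (y ! j) = 0"
        using d True by (metis extended_metric_on_def)
      then show ?thesis by simp
    next
      case False
      have "(\<lambda>k. if k = 0 then i else j) \<in> simplex_maps 1 n"
        using that by (auto simp: simplex_maps_def mono_on_def)
      moreover have "reindex 1 (\<lambda>k. if k = 0 then i else j) y = [y ! i, y ! j]"
        by (simp add: reindex_def)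
      ultimately have "?L [y ! i, y ! j] \<le> p"
        using A by metis
      then show ?thesis
        using False by (simp add: monoidal_length_def sublevel_graph_def p)
    qed
    have "d (y ! i) (y ! j) \<le> t" if "i \<le> n" "j \<le> n" for i j
    proof -
      have "y ! i \<in> V" "y ! j \<in> V"
        using A len that by (auto simp: subset_iff)
      then have "d (y ! i) (y ! j) = d (y ! j) (y ! i)"
        using d by (simp add: extended_metric_on_def)
      then show ?thesis
        using le[of i j] le[of j i] that by (cases "i \<le> j") auto
    qed
    then have "\<forall>v\<in>set y. \<forall>v'\<in>set y. \<gamma> v \<le> s \<and> d v v' \<le> t"
      using \<gamma> len by (auto simp: in_set_conv_nth less_Suc_eq_le)
    moreover have "set y \<noteq> {}"
      using len by auto
    ultimately show ?B
      using A by (simp add: sublevel_rips_def p)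
  next
    assume B: ?B
    have "?L (reindex m \<alpha> y) \<le> p" if "\<alpha> \<in> simplex_maps m n" for m \<alpha>
    proof (rule monoidal_length_sup_le)
      show "reindex m \<alpha> y \<noteq> []"
        by (simp add: reindex_def)
      have "set (reindex m \<alpha> y) \<subseteq> set y"
        using that len by (intro set_reindex_subset) (auto simp: simplex_maps_def less_Suc_eq_le)
      then show "?G v w \<le> p" if "v \<in> set (reindex m \<alpha> y)" "w \<in> set (reindex m \<alpha> y)" for v w
        using B that by (auto simp: sublevel_rips_def sublevel_graph_def p)
    qed (simp add: p)
    then show ?A
      using B by (auto simp: sublevel_rips_def p)
  qed
  then have "{y. length y = Suc n \<and> set y \<subseteq> V \<and> (\<forall>m. \<forall>\<alpha>\<in>simplex_maps m n. ?L (reindex m \<alpha> y) \<le> p)}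
      = {y. length y = Suc n \<and> set y \<in> sublevel_rips V d \<gamma> p}" for n
    by blast
  then show ?thesis
    by (simp add: sublevel_monoidal_rips_def monoidal_rips_def tuple_sset_def)
qed

section \<open>Tuples and oriented simplices as coned complexes\<close>

lemma basis_bdry_tuples:
  "basis_bdry (sset_complex (tuple_sset S)) (Suc n) y
    = (\<Sum>i\<le>Suc n. Poly_Mapping.single (reindex n (coface i) y) ((-1) ^ i))"
  by (simp add: sset_complex_def tuple_sset_def)

lemma augmentation_single [simp]: "augmentation (Poly_Mapping.single x a) = Poly_Mapping.single () a"
  by (simp add: augmentation_def)

text \<open>Deleting the first entry of \<open>v # y\<close> leaves \<open>y\<close>; deleting any later entry deletes one from \<open>y\<close>, with
  the index and hence the sign shifted by one.\<close>

lemma tuple_bdry_Cons: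
  fixes C :: "('v list, 'k::field) based_complex" and S :: "'v set set"
  defines "C \<equiv> sset_complex (tuple_sset S)"
  shows "length y = Suc (Suc n) \<Longrightarrow> basis_bdry C (Suc (Suc n)) (v # y)
      = Poly_Mapping.single y 1 - lin (\<lambda>z. Poly_Mapping.single (v # z) 1) (basis_bdry C (Suc n) y)"
    and "length y = Suc 0 \<Longrightarrow> basis_bdry C (Suc 0) (v # y)
      = Poly_Mapping.single y 1 - Poly_Mapping.single [v] 1"
proof -
  have face_0: "reindex n (coface 0) (v # y) = y" if "length y = Suc n" for n and y :: "'v list"
    using that by (intro nth_equalityI) (auto simp: nth_reindex coface_def)
  have face_Suc: "reindex (Suc n) (coface (Suc i)) (v # y) = v # reindex n (coface i) y" for i n and y :: "'v list"
  proof (intro nth_equalityI)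
    fix j assume "j < length (reindex (Suc n) (coface (Suc i)) (v # y))"
    then show "reindex (Suc n) (coface (Suc i)) (v # y) ! j = (v # reindex n (coface i) y) ! j"
      by (cases j) (auto simp: nth_reindex coface_def)
  qed simp
  show "basis_bdry C (Suc (Suc n)) (v # y)
      = Poly_Mapping.single y 1 - lin (\<lambda>z. Poly_Mapping.single (v # z) 1) (basis_bdry C (Suc n) y)"
    if "length y = Suc (Suc n)"
    using that unfolding C_def basis_bdry_tuples
    by (subst sum.atMost_Suc_shift)
      (simp add: face_0 face_Suc lin_sum single_uminus sum_negf del: sum.atMost_Suc)
  show "basis_bdry C (Suc 0) (v # y) = Poly_Mapping.single y 1 - Poly_Mapping.single [v] 1"
    if "length y = Suc 0"
  proof -
    have "reindex 0 (coface (Suc 0)) (v # y) = [v]"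
      by (simp add: reindex_def coface_def)
    then show ?thesis
      using that by (simp add: C_def basis_bdry_tuples face_0 single_uminus)
  qed
qed

lemma asc_face: "abstract_simplicial_complex S \<Longrightarrow> \<sigma> \<in> S \<Longrightarrow> \<tau> \<subseteq> \<sigma> \<Longrightarrow> \<tau> \<noteq> {} \<Longrightarrow> \<tau> \<in> S"
  unfolding abstract_simplicial_complex_def by blast

text \<open>Putting a vertex \<open>v\<close> of \<open>\<sigma>\<close> in front of a tuple is a cone operator, whether or not \<open>v\<close> occurs in the
  tuple already, because degenerate tuples are basis elements too.\<close>

lemma coned_complex_tuples:
  assumes S: "abstract_simplicial_complex S"
  shows "coned_complex (sset_complex (tuple_sset S) :: ('v list, 'k::field) based_complex) set S"
proof -
  let ?C = "sset_complex (tuple_sset S) :: ('v list, 'k) based_complex"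
  have basis: "basis ?C n = {y. length y = Suc n \<and> set y \<in> S}" for n
    by (simp add: sset_complex_def tuple_sset_def)
  have cone: "cone_operator ?C set \<sigma> (\<lambda>y. Poly_Mapping.single (v # y) 1)" if "v \<in> \<sigma>" "\<sigma> \<in> S" for v \<sigma>
    unfolding cone_operator_def
  proof (intro conjI allI ballI impI)
    show "Poly_Mapping.single (v # y) 1 \<in> chains_in ?C set (Suc n) \<sigma>"
      if "y \<in> basis ?C n" "set y \<subseteq> \<sigma>" for n y
      using that \<open>v \<in> \<sigma>\<close> asc_face[OF S \<open>\<sigma> \<in> S\<close>, of "set (v # y)"]
      by (intro chains_in_single) (auto simp: basis)
    show "bdry ?C (Suc (Suc n)) (Poly_Mapping.single (v # y) 1) =
        Poly_Mapping.single y 1 - lin (\<lambda>y. Poly_Mapping.single (v # y) 1) (basis_bdry ?C (Suc n) y)"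
      if "y \<in> basis ?C (Suc n)" for n y
      using that by (simp add: bdry_eq_lin chain_scale_algebra tuple_bdry_Cons basis)
    show "\<exists>b\<in>chains_in ?C set 0 \<sigma>. augmentation b = Poly_Mapping.single () 1 \<and>
        (\<forall>y\<in>basis ?C 0. set y \<subseteq> \<sigma> \<longrightarrow>
           bdry ?C (Suc 0) (Poly_Mapping.single (v # y) 1) = Poly_Mapping.single y 1 - b)"
      using asc_face[OF S \<open>\<sigma> \<in> S\<close>, of "{v}"] \<open>v \<in> \<sigma>\<close>
      by (intro bexI[of _ "Poly_Mapping.single [v] 1"] conjI ballI chains_in_single)
        (auto simp: bdry_eq_lin chain_scale_algebra tuple_bdry_Cons basis)
  qed
  show ?thesis
  proof
    show "set y \<in> S" if "y \<in> basis ?C n" for y n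
      using that by (simp add: basis)
    show "basis_bdry ?C (Suc n) y \<in> chains_in ?C set n (set y)" if y: "y \<in> basis ?C (Suc n)" for y n
    proof -
      have "set (reindex n (coface i) y) \<subseteq> set y" for i
        using y by (intro set_reindex_subset) (auto simp: basis coface_def)
      moreover have "set (reindex n (coface i) y) \<noteq> {}" for i
        by (simp add: reindex_def)
      ultimately have "Poly_Mapping.single (reindex n (coface i) y) a \<in> chains_in ?C set n (set y)"
        for i and a :: 'k
        using y asc_face[OF S, of "set y"] by (intro chains_in_single) (auto simp: basis)
      then show ?thesis
        unfolding basis_bdry_tuples by (intro chains_in_sum)
    qed
    show "augmentation (basis_bdry ?C (Suc 0) y) = 0" if y: "y \<in> basis ?C (Suc 0)" for y
    proof -
      obtain v z where "y = v # z" "length z = Suc 0"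
        using y by (auto simp: basis length_Suc_conv)
      then show ?thesis
        by (simp add: tuple_bdry_Cons) (simp add: augmentation_def lin_diff)
    qed
    show "\<exists>h. cone_operator ?C set \<sigma> h" if \<sigma>: "\<sigma> \<in> S" for \<sigma>
    proof -
      obtain v where "v \<in> \<sigma>"
        using \<sigma> S unfolding abstract_simplicial_complex_def by blast
      then show ?thesis
        using cone[OF _ \<sigma>] by blast
    qed
    show "\<exists>h z. cone_operator ?C set (set y) h \<and> z \<in> basis ?C n \<and> set z \<subseteq> set y \<and>
        h z = Poly_Mapping.single y 1" if y: "y \<in> basis ?C (Suc n)" for y n
    proof -
      obtain v z where yz: "y = v # z" "length z = Suc n"
        using y by (auto simp: basis length_Suc_conv)
      moreover from this have "z \<noteq> []"
        by auto
      ultimately have "set z \<in> S"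
        using y asc_face[OF S, of "set y" "set z"] by (auto simp: basis)
      then show ?thesis
        using yz y cone[of v "set y"] by (auto simp: basis intro!: exI[of _ "\<lambda>y. Poly_Mapping.single (v # y) 1"] exI[of _ z])
    qed
  qed
qed

lemma ex_least:
  assumes r: "linear_order_on V r" and "\<sigma> \<subseteq> V" "finite \<sigma>" "\<sigma> \<noteq> {}"
  shows "\<exists>v\<in>\<sigma>. \<forall>w\<in>\<sigma>. (v, w) \<in> r"
  using \<open>finite \<sigma>\<close> \<open>\<sigma> \<noteq> {}\<close> \<open>\<sigma> \<subseteq> V\<close>
proof (induction \<sigma> rule: finite_ne_induct)
  case (singleton v)
  then show ?case
    using r by (auto simp: order_on_defs refl_on_def)
next
  case (insert x \<sigma>)
  then obtain v where v: "v \<in> \<sigma>" "\<forall>w\<in>\<sigma>. (v, w) \<in> r" by auto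
  have refl: "(x, x) \<in> r" and tot: "(x, v) \<in> r \<or> (v, x) \<in> r"
    using r insert v by (auto simp: order_on_defs refl_on_def total_on_def)
  from tot show ?case
  proof
    assume "(x, v) \<in> r"
    then have "\<forall>w\<in>\<sigma>. (x, w) \<in> r"
      using v r by (auto simp: order_on_defs dest: transD)
    then show ?thesis using refl by auto
  qed (use v in auto)
qed

text \<open>If \<open>v\<close> precedes all vertices of \<open>\<tau>\<close>, then adding \<open>v\<close> raises the position of each of them by one,
  which accounts for the minus sign.\<close>

lemma ordered_bdry_insert:
  fixes D :: "('v set, 'k::field) based_complex" and S :: "'v set set" and r :: "('v \<times> 'v) set"
  defines "D \<equiv> ordered_complex r S"
  assumes r: "linear_order_on V r" and v: "\<forall>w\<in>\<tau>. (v, w) \<in> r" "v \<notin> \<tau>" "finite \<tau>" 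
  shows "basis_bdry D (Suc n) (insert v \<tau>) = Poly_Mapping.single \<tau> 1 -
    (\<Sum>w\<in>\<tau>. Poly_Mapping.single (insert v (\<tau> - {w})) ((-1) ^ card {u \<in> \<tau>. u \<noteq> w \<and> (u, w) \<in> r}))"
proof -
  have no: "\<not> (w, v) \<in> r" if "w \<in> \<tau>" for w
    using that r v by (auto simp: order_on_defs antisym_def)
  have card: "card {u \<in> insert v \<tau>. u \<noteq> w \<and> (u, w) \<in> r} = Suc (card {u \<in> \<tau>. u \<noteq> w \<and> (u, w) \<in> r})"
    if "w \<in> \<tau>" for w
  proof -
    have "{u \<in> insert v \<tau>. u \<noteq> w \<and> (u, w) \<in> r} = insert v {u \<in> \<tau>. u \<noteq> w \<and> (u, w) \<in> r}"
      using that v by auto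
    then show ?thesis
      using v by simp
  qed
  have "{u \<in> insert v \<tau>. u \<noteq> v \<and> (u, v) \<in> r} = {}"
    using no by auto
  then have card_v: "card {u \<in> insert v \<tau>. u \<noteq> v \<and> (u, v) \<in> r} = 0"
    by (metis card.empty)
  have "basis_bdry D (Suc n) (insert v \<tau>) = (\<Sum>w\<in>insert v \<tau>.
      Poly_Mapping.single (insert v \<tau> - {w}) ((-1) ^ card {u \<in> insert v \<tau>. u \<noteq> w \<and> (u, w) \<in> r}))"
    by (simp add: D_def ordered_complex_def del: sum.insert insert_iff)
  also have "\<dots> = Poly_Mapping.single (insert v \<tau> - {v}) 1 +
      (\<Sum>w\<in>\<tau>. Poly_Mapping.single (insert v \<tau> - {w})
        ((-1) ^ card {u \<in> insert v \<tau>. u \<noteq> w \<and> (u, w) \<in> r}))"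
    using v by (simp only: sum.insert card_v power_0 not_False_eq_True)
  also have "(\<Sum>w\<in>\<tau>. Poly_Mapping.single (insert v \<tau> - {w})
        ((-1::'k) ^ card {u \<in> insert v \<tau>. u \<noteq> w \<and> (u, w) \<in> r}))
      = (\<Sum>w\<in>\<tau>. - Poly_Mapping.single (insert v (\<tau> - {w})) ((-1) ^ card {u \<in> \<tau>. u \<noteq> w \<and> (u, w) \<in> r}))"
  proof (rule sum.cong[OF refl])
    fix w assume "w \<in> \<tau>"
    moreover from this have "insert v \<tau> - {w} = insert v (\<tau> - {w})"
      using v by auto
    ultimately show "Poly_Mapping.single (insert v \<tau> - {w})
        ((-1::'k) ^ card {u \<in> insert v \<tau>. u \<noteq> w \<and> (u, w) \<in> r})
      = - Poly_Mapping.single (insert v (\<tau> - {w})) ((-1) ^ card {u \<in> \<tau>. u \<noteq> w \<and> (u, w) \<in> r})"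
      by (simp only: card) (simp add: single_uminus)
  qed
  finally show ?thesis
    using v by (simp add: sum_negf)
qed

lemma ordered_bdry_pair:
  assumes "linear_order_on V r" "(v, w) \<in> r" "v \<noteq> w"
  shows "basis_bdry (ordered_complex r S :: ('v set, 'k::field) based_complex) (Suc 0) {v, w}
    = Poly_Mapping.single {w} 1 - Poly_Mapping.single {v} 1"
proof -
  have "{u. u = w \<and> u \<noteq> w \<and> (u, w) \<in> r} = {}" by auto
  then have no_smaller: "card {u. u = w \<and> u \<noteq> w \<and> (u, w) \<in> r} = 0"
    by (metis card.empty)
  show ?thesis
    using ordered_bdry_insert[OF assms(1), of "{w}" v S 0, where 'k='k] assms
    by (simp add: no_smaller)
qed

text \<open>The apex \<open>v\<close> is the least vertex, so that it enters every simplex in position 0, with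
  sign \<open>+1\<close>. When \<open>v \<in> \<tau>\<close> the cone degenerates to 0, and the cone identity then says that coning the face of
  \<open>\<tau>\<close> opposite to \<open>v\<close> gives back \<open>\<tau>\<close>.\<close>

lemma cone_operator_ordered:
  fixes D :: "('v set, 'k::field) based_complex" and S :: "'v set set" and r :: "('v \<times> 'v) set"
  defines "D \<equiv> ordered_complex r S"
  assumes r: "linear_order_on V r" and S: "abstract_simplicial_complex S" and \<sigma>: "\<sigma> \<in> S"
    and v: "v \<in> \<sigma>" "\<forall>w\<in>\<sigma>. (v, w) \<in> r"
  shows "cone_operator D (\<lambda>\<tau>. \<tau>) \<sigma> (\<lambda>\<tau>. if v \<in> \<tau> then 0 else Poly_Mapping.single (insert v \<tau>) 1)"
    (is "cone_operator D _ \<sigma> ?h")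
proof -
  have basis: "basis D n = {\<tau> \<in> S. card \<tau> = Suc n}" for n
    by (simp add: D_def ordered_complex_def)
  have fin: "finite \<tau>" if "\<tau> \<subseteq> \<sigma>" for \<tau>
    using \<sigma> S by (intro finite_subset[OF that]) (simp add: abstract_simplicial_complex_def)
  have bdry: "basis_bdry D (Suc n) (insert v \<tau>) = Poly_Mapping.single \<tau> 1 -
      (\<Sum>w\<in>\<tau>. Poly_Mapping.single (insert v (\<tau> - {w})) ((-1) ^ card {u \<in> \<tau>. u \<noteq> w \<and> (u, w) \<in> r}))"
    if "\<tau> \<subseteq> \<sigma>" "v \<notin> \<tau>" for n \<tau>
    unfolding D_def using that v fin by (intro ordered_bdry_insert[OF r]) auto
  show ?thesis
    unfolding cone_operator_def
  proof (intro conjI allI ballI impI)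
    show "?h \<tau> \<in> chains_in D (\<lambda>\<tau>. \<tau>) (Suc n) \<sigma>" if "\<tau> \<in> basis D n" "\<tau> \<subseteq> \<sigma>" for n \<tau>
    proof (cases "v \<in> \<tau>")
      case False
      then have "insert v \<tau> \<in> basis D (Suc n)"
        using that v fin[OF that(2)] asc_face[OF S \<sigma>, of "insert v \<tau>"] by (auto simp: basis)
      then show ?thesis
        using that v False by (auto intro: chains_in_single)
    qed (simp add: chains_in_def)
    show "bdry D (Suc (Suc n)) (?h \<tau>) = Poly_Mapping.single \<tau> 1 - lin ?h (basis_bdry D (Suc n) \<tau>)"
      if \<tau>: "\<tau> \<in> basis D (Suc n)" "\<tau> \<subseteq> \<sigma>" for n \<tau>
    proof (cases "v \<in> \<tau>")
      case False
      have "lin ?h (basis_bdry D (Suc n) \<tau>)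
        = (\<Sum>w\<in>\<tau>. Poly_Mapping.single (insert v (\<tau> - {w})) ((-1) ^ card {u \<in> \<tau>. u \<noteq> w \<and> (u, w) \<in> r}))"
        using False by (simp add: D_def ordered_complex_def lin_sum)
      then show ?thesis
        using False bdry[OF \<tau>(2)] by (simp add: bdry_eq_lin chain_scale_algebra)
    next
      case True
      define \<rho> where "\<rho> = \<tau> - {v}"
      have \<rho>: "\<tau> = insert v \<rho>" "\<rho> \<subseteq> \<sigma>" "v \<notin> \<rho>"
        using True \<tau> by (auto simp: \<rho>_def)
      have "lin ?h (basis_bdry D (Suc n) \<tau>) = Poly_Mapping.single \<tau> 1"
        unfolding \<rho>(1) bdry[OF \<rho>(2,3)] lin_diff lin_sum
        using \<rho>(3) by (simp add: chain_scale_algebra)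
      then show ?thesis
        using True by (simp add: bdry_eq_lin)
    qed
    show "\<exists>b\<in>chains_in D (\<lambda>\<tau>. \<tau>) 0 \<sigma>. augmentation b = Poly_Mapping.single () 1 \<and>
        (\<forall>\<tau>\<in>basis D 0. \<tau> \<subseteq> \<sigma> \<longrightarrow> bdry D (Suc 0) (?h \<tau>) = Poly_Mapping.single \<tau> 1 - b)"
    proof (intro bexI[of _ "Poly_Mapping.single {v} 1"] conjI ballI impI)
      show "Poly_Mapping.single {v} 1 \<in> chains_in D (\<lambda>\<tau>. \<tau>) 0 \<sigma>"
        using asc_face[OF S \<sigma>, of "{v}"] v by (intro chains_in_single) (auto simp: basis)
      fix \<tau> assume "\<tau> \<in> basis D 0" "\<tau> \<subseteq> \<sigma>"
      then obtain w where w: "\<tau> = {w}" "w \<in> \<sigma>"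
        by (auto simp: basis card_1_singleton_iff)
      then show "bdry D (Suc 0) (?h \<tau>) = Poly_Mapping.single \<tau> 1 - Poly_Mapping.single {v} 1"
        using v ordered_bdry_pair[OF r, of v w S, where 'k='k]
        by (auto simp: bdry_eq_lin chain_scale_algebra D_def)
    qed simp
  qed
qed

lemma coned_complex_ordered:
  fixes S :: "'v set set"
  assumes r: "linear_order_on V r" and S: "abstract_simplicial_complex S" and V: "\<Union>S \<subseteq> V"
  shows "coned_complex (ordered_complex r S :: ('v set, 'k::field) based_complex) (\<lambda>\<sigma>. \<sigma>) S"
proof -
  let ?D = "ordered_complex r S :: ('v set, 'k) based_complex"
  have basis: "basis ?D n = {\<tau> \<in> S. card \<tau> = Suc n}" for n
    by (simp add: ordered_complex_def)
  have least: "\<exists>v\<in>\<sigma>. \<forall>w\<in>\<sigma>. (v, w) \<in> r" if "\<sigma> \<in> S" for \<sigma>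
    using that S V by (intro ex_least[OF r]) (auto simp: abstract_simplicial_complex_def)
  have fin: "finite \<tau>" if "\<tau> \<in> S" for \<tau>
    using that S by (auto simp: abstract_simplicial_complex_def)
  show ?thesis
  proof
    show "\<sigma> \<in> S" if "\<sigma> \<in> basis ?D n" for \<sigma> n
      using that by (simp add: basis)
    show "basis_bdry ?D (Suc n) \<sigma> \<in> chains_in ?D (\<lambda>\<sigma>. \<sigma>) n \<sigma>" if \<sigma>: "\<sigma> \<in> basis ?D (Suc n)" for \<sigma> n
    proof -
      have "Poly_Mapping.single (\<sigma> - {w}) a \<in> chains_in ?D (\<lambda>\<sigma>. \<sigma>) n \<sigma>"
        if "w \<in> \<sigma>" for w and a :: 'k
      proof (rule chains_in_single)
        have "card (\<sigma> - {w}) = Suc n"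
          using that \<sigma> fin by (auto simp: basis)
        moreover from this have "\<sigma> - {w} \<noteq> {}"
          by (metis card.empty nat.distinct(1))
        ultimately show "\<sigma> - {w} \<in> basis ?D n"
          using \<sigma> asc_face[OF S _ Diff_subset] by (auto simp: basis)
      qed auto
      then have "(\<Sum>w\<in>\<sigma>. Poly_Mapping.single (\<sigma> - {w}) ((-1) ^ card {u \<in> \<sigma>. u \<noteq> w \<and> (u, w) \<in> r}))
          \<in> chains_in ?D (\<lambda>\<sigma>. \<sigma>) n \<sigma>"
        by (intro chains_in_sum)
      then show ?thesis
        by (simp add: ordered_complex_def)
    qed
    show "augmentation (basis_bdry ?D (Suc 0) \<sigma>) = 0" if \<sigma>: "\<sigma> \<in> basis ?D (Suc 0)" for \<sigma>
    proof -
      obtain v where v: "v \<in> \<sigma>" "\<forall>w\<in>\<sigma>. (v, w) \<in> r"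
        using least \<sigma> by (auto simp: basis)
      have "card (\<sigma> - {v}) = Suc 0"
        using v \<sigma> fin by (auto simp: basis)
      then obtain w where w: "\<sigma> - {v} = {w}"
        by (auto simp: card_1_singleton_iff)
      then have *: "\<sigma> = insert v {w}" "v \<noteq> w"
        using v by auto
      then show ?thesis
        using v ordered_bdry_pair[OF r, of v w S, where 'k='k]
        by (simp add: augmentation_def lin_diff)
    qed
    show "\<exists>h. cone_operator ?D (\<lambda>\<sigma>. \<sigma>) \<sigma> h" if "\<sigma> \<in> S" for \<sigma>
      using least[OF that] cone_operator_ordered[OF r S that] by blast
    show "\<exists>h \<tau>. cone_operator ?D (\<lambda>\<sigma>. \<sigma>) \<sigma> h \<and> \<tau> \<in> basis ?D n \<and> \<tau> \<subseteq> \<sigma> \<and>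
        h \<tau> = Poly_Mapping.single \<sigma> 1" if \<sigma>: "\<sigma> \<in> basis ?D (Suc n)" for \<sigma> n
    proof -
      have \<sigma>S: "\<sigma> \<in> S" using \<sigma> by (simp add: basis)
      obtain v where v: "v \<in> \<sigma>" "\<forall>w\<in>\<sigma>. (v, w) \<in> r"
        using least[OF \<sigma>S] by blast
      have "card (\<sigma> - {v}) = Suc n"
        using v \<sigma> fin by (auto simp: basis)
      moreover from this have "\<sigma> - {v} \<noteq> {}"
        by (metis card.empty nat.distinct(1))
      ultimately have "\<sigma> - {v} \<in> basis ?D n"
        using asc_face[OF S \<sigma>S Diff_subset] by (auto simp: basis)
      moreover have "insert v (\<sigma> - {v}) = \<sigma>"
        using v by auto
      ultimately show ?thesis
        using cone_operator_ordered[OF r S \<sigma>S v]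
        by (intro exI[of _ "\<lambda>\<tau>. if v \<in> \<tau> then 0 else Poly_Mapping.single (insert v \<tau>) 1"]
            exI[of _ "\<sigma> - {v}"]) auto
    qed
  qed
qed

text \<open>Both chain complexes of \<open>K i\<close> are the restrictions to \<open>K i\<close> of coned complexes over the
  common family \<open>S\<close>.\<close>

theorem persistent_homology_tuples_ordered:
  fixes K :: "'i::order \<Rightarrow> 'v set set"
  assumes r: "linear_order_on V r" and S: "abstract_simplicial_complex S" and V: "\<Union>S \<subseteq> V"
    and K: "\<And>i. abstract_simplicial_complex (K i)" "\<And>i. K i \<subseteq> S"
    and mono: "\<And>i j. i \<le> j \<Longrightarrow> K i \<subseteq> K j"
  shows "isomorphic_persistence_modules
    (persistent_homology n (\<lambda>i. sset_complex (tuple_sset (K i)) :: ('v list, 'k::field) based_complex))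
    (persistent_homology n (\<lambda>i. ordered_complex r (K i) :: ('v set, 'k) based_complex))"
proof -
  have sub: "subfamily (K i) S" for i
    using K(2)[of i] asc_face[OF K(1)[of i]] S
    unfolding subfamily_def abstract_simplicial_complex_def by blast
  have "{y. length y = Suc n \<and> set y \<in> K i} = {y. (length y = Suc n \<and> set y \<in> S) \<and> set y \<in> K i}"
    and "{\<sigma> \<in> K i. card \<sigma> = Suc n} = {\<sigma>. (\<sigma> \<in> S \<and> card \<sigma> = Suc n) \<and> \<sigma> \<in> K i}" for i n
    using K(2)[of i] by blast+
  then have eqs: "sset_complex (tuple_sset (K i)) = restrict_complex (sset_complex (tuple_sset S)) set (K i)"
    "ordered_complex r (K i) = restrict_complex (ordered_complex r S) (\<lambda>\<sigma>. \<sigma>) (K i)" for i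
    by (simp_all add: sset_complex_def tuple_sset_def ordered_complex_def restrict_complex_def
        cong: if_cong)
  show ?thesis
    unfolding eqs
    by (intro coned_complexes_isomorphic[OF coned_complex_tuples[OF S] coned_complex_ordered[OF r S V]]
        sub mono)
qed

section \<open>Maps out of geometric realizations\<close>

lemma powertop_real_subtopology [simp]: "subtopology (powertop_real UNIV) S = top_of_set S"
  by (simp add: euclidean_product_topology)

lemma topspace_complex_realization [simp]:
  fixes K :: "'v set set"
  shows "topspace (complex_realization K) = \<Union>(geometric_face ` K)"
proof -
  have "\<Union>(geometric_face ` K) \<inter> geometric_face \<sigma> = geometric_face \<sigma>" if "\<sigma> \<in> K" for \<sigma>
    using that by auto
  then have "openin (complex_realization K) (\<Union>(geometric_face ` K))"
    unfolding openin_complex_realization by auto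
  moreover have "topspace (complex_realization K) \<subseteq> \<Union>(geometric_face ` K)"
    using openin_complex_realization openin_topspace by blast
  ultimately show ?thesis
    by (meson openin_subset subset_antisym)
qed

lemma continuous_map_from_complex:
  fixes K :: "'v set set"
  assumes "\<And>\<sigma>. \<sigma> \<in> K \<Longrightarrow> continuous_map (top_of_set (geometric_face \<sigma>)) Y g"
  shows "continuous_map (complex_realization K) Y g"
  unfolding continuous_map_def
proof (intro conjI allI impI)
  show "g \<in> topspace (complex_realization K) \<rightarrow> topspace Y"
    using assms by (fastforce simp: continuous_map_def)
  fix U assume U: "openin Y U"
  have "{x \<in> topspace (complex_realization K). g x \<in> U} \<inter> geometric_face \<sigma>
      = {x \<in> geometric_face \<sigma>. g x \<in> U}" if "\<sigma> \<in> K" for \<sigma>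
    using that by auto
  then show "openin (complex_realization K) {x \<in> topspace (complex_realization K). g x \<in> U}"
    using assms U by (auto simp: openin_complex_realization continuous_map_def)
qed

lemma continuous_map_into_complex:
  fixes K :: "'v set set"
  assumes "\<sigma> \<in> K" and f: "continuous_on S f" "f ` S \<subseteq> geometric_face \<sigma>"
  shows "continuous_map (top_of_set S) (complex_realization K) f"
proof -
  have "continuous_map (top_of_set (geometric_face \<sigma>)) (complex_realization K) id"
    unfolding continuous_map_def
  proof (intro conjI allI impI)
    show "id \<in> topspace (top_of_set (geometric_face \<sigma>)) \<rightarrow> topspace (complex_realization K)"
      using assms by auto
    fix U assume "openin (complex_realization K) U"
    moreover have "{x \<in> topspace (top_of_set (geometric_face \<sigma>)). id x \<in> U} = U \<inter> geometric_face \<sigma>"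
      by auto
    ultimately show "openin (top_of_set (geometric_face \<sigma>))
        {x \<in> topspace (top_of_set (geometric_face \<sigma>)). id x \<in> U}"
      using assms by (simp add: openin_complex_realization)
  qed
  have "continuous_map (top_of_set S) (top_of_set (geometric_face \<sigma>)) f"
    using f by (auto simp: continuous_map_in_subtopology)
  from continuous_map_compose[OF this \<open>continuous_map (top_of_set (geometric_face \<sigma>)) _ id\<close>]
  show ?thesis
    by simp
qed

lemma topspace_prerealization:
  "topspace (prerealization X) = {(n, y, l). y \<in> simp X n \<and> l \<in> standard_simplex n}"
  by (auto simp: prerealization_def)

lemma openin_prerealization_cell:
  assumes "y \<in> simp X n"
  shows "openin (prerealization X) {(n', y', l). n' = n \<and> y' = y \<and> l \<in> standard_simplex n}"
proof -
  have eq: "{x. (i, x) \<in> {(n', y', l). n' = n \<and> y' = y \<and> l \<in> standard_simplex n}}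
      = (if i = n then {y} \<times> standard_simplex n else {})" for i
    by auto
  show ?thesis
    unfolding prerealization_def openin_sum_topology eq using assms
    by (auto simp: openin_prod_Times_iff)
qed

lemma continuous_map_cell:
  assumes "y \<in> simp X n"
  shows "continuous_map (top_of_set (standard_simplex n)) (prerealization X) (\<lambda>l. (n, y, l))"
proof -
  let ?P = "\<lambda>n. prod_topology (discrete_topology (simp X n)) (top_of_set (standard_simplex n))"
  have "continuous_map (top_of_set (standard_simplex n)) (?P n) (\<lambda>l. (y, l))"
    using assms by (intro continuous_map_pairedI) auto
  moreover have "continuous_map (?P n) (sum_topology ?P UNIV) (\<lambda>x. (n, x))"
    by (rule continuous_map_component_injection) simp
  ultimately have "continuous_map (top_of_set (standard_simplex n)) (sum_topology ?P UNIV)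
      ((\<lambda>x. (n, x)) \<circ> (\<lambda>l. (y, l)))"
    by (rule continuous_map_compose)
  then show ?thesis
    by (simp add: prerealization_def o_def)
qed

lemma continuous_map_coordinates:
  "continuous_map (prerealization X) euclidean (\<lambda>a. snd (snd a))"
  unfolding continuous_map_def
proof (intro conjI allI impI)
  fix U :: "(nat \<Rightarrow> real) set" assume "openin euclidean U"
  have eq: "{x. (n, x) \<in> {a \<in> topspace (prerealization X). snd (snd a) \<in> U}}
      = simp X n \<times> (standard_simplex n \<inter> U)" for n
    by (auto simp: topspace_prerealization)
  show "openin (prerealization X) {a \<in> topspace (prerealization X). snd (snd a) \<in> U}"
    unfolding prerealization_def openin_sum_topology
  proof (intro conjI ballI)
    fix n :: nat
    have "openin (top_of_set (standard_simplex n)) (standard_simplex n \<inter> U)"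
      using \<open>openin euclidean U\<close> by (auto simp: openin_open)
    then show "openin (prod_topology (discrete_topology (simp X n))
        (subtopology (powertop_real UNIV) (standard_simplex n)))
        {x. (n, x) \<in> {a \<in> topspace (sum_topology (\<lambda>n. prod_topology (discrete_topology (simp X n))
          (subtopology (powertop_real UNIV) (standard_simplex n))) UNIV). snd (snd a) \<in> U}}"
      using eq[of n] unfolding prerealization_def by (simp add: openin_prod_Times_iff)
  qed auto
qed auto

text \<open>The cells \<open>{y} \<times> \<Delta>\<^sup>n\<close> are open in the disjoint union of all simplices, so continuity can be tested on
  them, also in the presence of a parameter space \<open>Z\<close> (for homotopies, the unit interval).\<close>

lemma continuous_map_from_prod_prerealization:
  assumes h: "\<And>n y. y \<in> simp X n \<Longrightarrow>
    continuous_map (prod_topology Z (top_of_set (standard_simplex n))) Y (\<lambda>(z, l). h (z, n, y, l))"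
  shows "continuous_map (prod_topology Z (prerealization X)) Y h"
proof (rule pasting_lemma[where I = "Sigma UNIV (simp X)" and f = "\<lambda>_. h"
      and T = "\<lambda>(n, y). topspace Z \<times> {(n', y', l). n' = n \<and> y' = y \<and> l \<in> standard_simplex n}"])
  fix i assume i: "i \<in> Sigma UNIV (simp X)"
  obtain n y where ny: "i = (n, y)" by fastforce
  then have y: "y \<in> simp X n" using i by simp
  let ?T = "topspace Z \<times> {(n', y', l). n' = n \<and> y' = y \<and> l \<in> standard_simplex n}"
  let ?S = "subtopology (prod_topology Z (prerealization X)) ?T"
  show "openin (prod_topology Z (prerealization X)) (case i of (n, y) \<Rightarrow>
      topspace Z \<times> {(n', y', l). n' = n \<and> y' = y \<and> l \<in> standard_simplex n})"
    using openin_prerealization_cell[OF y] by (simp add: ny openin_prod_Times_iff)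
  have "continuous_map ?S euclidean ((\<lambda>a. snd (snd a)) \<circ> snd)"
    by (intro continuous_map_compose[OF continuous_map_from_subtopology[OF continuous_map_snd]]
        continuous_map_coordinates)
  then have "continuous_map ?S (top_of_set (standard_simplex n)) ((\<lambda>a. snd (snd a)) \<circ> snd)"
    by (auto simp: continuous_map_in_subtopology)
  with continuous_map_from_subtopology[OF continuous_map_fst]
  have "continuous_map ?S (prod_topology Z (top_of_set (standard_simplex n)))
      (\<lambda>x. (fst x, ((\<lambda>a. snd (snd a)) \<circ> snd) x))"
    by (rule continuous_map_pairedI)
  from continuous_map_compose[OF this h[OF y]]
  have "continuous_map ?S Y h"
    by (rule continuous_map_eq) auto
  then show "continuous_map (subtopology (prod_topology Z (prerealization X)) (case i of (n, y) \<Rightarrow>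
      topspace Z \<times> {(n', y', l). n' = n \<and> y' = y \<and> l \<in> standard_simplex n})) Y h"
    by (simp add: ny)
next
  fix x assume "x \<in> topspace (prod_topology Z (prerealization X))"
  then obtain z n y l where "x = (z, n, y, l)" "z \<in> topspace Z" "y \<in> simp X n" "l \<in> standard_simplex n"
    by (auto simp: topspace_prerealization)
  then show "\<exists>j. j \<in> Sigma UNIV (simp X) \<and> x \<in> (case j of (n, y) \<Rightarrow>
      topspace Z \<times> {(n', y', l). n' = n \<and> y' = y \<and> l \<in> standard_simplex n}) \<and> h x = h x"
    by (intro exI[of _ "(n, y)"]) auto
qed auto

lemma continuous_map_from_prerealization:
  assumes h: "\<And>n y. y \<in> simp X n \<Longrightarrow>
    continuous_map (top_of_set (standard_simplex n)) Y (\<lambda>l. h (n, y, l))"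
  shows "continuous_map (prerealization X) Y h"
proof -
  let ?Z = "discrete_topology {()}"
  have "continuous_map (prod_topology ?Z (prerealization X)) Y (h \<circ> snd)"
  proof (rule continuous_map_from_prod_prerealization)
    show "continuous_map (prod_topology ?Z (top_of_set (standard_simplex n))) Y
        (\<lambda>(z, l). (h \<circ> snd) (z, n, y, l))" if "y \<in> simp X n" for n y
      using continuous_map_compose[OF continuous_map_snd h[OF that]]
      by (simp add: o_def case_prod_unfold)
  qed
  moreover have "continuous_map (prerealization X) (prod_topology ?Z (prerealization X)) (\<lambda>a. ((), a))"
    by (intro continuous_map_pairedI) auto
  ultimately have "continuous_map (prerealization X) Y ((h \<circ> snd) \<circ> (\<lambda>a. ((), a)))"
    by (rule continuous_map_compose[rotated])
  then show ?thesis
    by (simp add: o_def)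
qed

definition realization_point :: "'x sset \<Rightarrow> nat \<times> 'x \<times> (nat \<Rightarrow> real) \<Rightarrow> (nat \<times> 'x \<times> (nat \<Rightarrow> real)) set"
  where "realization_point X a = realization_rel X `` {a}"

lemma quotient_map_realization_point:
  "quotient_map (prerealization X) (realization X) (realization_point X)"
  unfolding quotient_map_def realization_def
  by (auto simp: openin_quotient_topology quotient_def realization_point_def)

lemma topspace_realizationE:
  assumes "c \<in> topspace (realization X)"
  obtains a where "a \<in> topspace (prerealization X)" "c = realization_point X a"
  using assms quotient_map_realization_point[of X] unfolding quotient_map_def by blast

lemma realization_rel_invariant:
  assumes F: "\<And>a b. realization_glue X a b \<Longrightarrow> F a = F b" and ab: "(a, b) \<in> realization_rel X"
  shows "F a = F b"
proof -
  have "equivclp (realization_glue X) a b"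
    using ab by (simp add: realization_rel_def)
  then show ?thesis
    by (induction rule: equivclp_induct) (auto dest: F)
qed

lemma in_realization_point:
  "a \<in> topspace (prerealization X) \<Longrightarrow> b \<in> realization_point X a \<longleftrightarrow> (a, b) \<in> realization_rel X"
  by (simp add: realization_point_def)

text \<open>Used only for \<open>F\<close> that are constant on each class \<open>c\<close>. The definition makes no
  reference to the equivalence relation, so the same function works for all stages of a
  filtration.\<close>

definition descend :: "('a \<Rightarrow> 'b) \<Rightarrow> 'a set \<Rightarrow> 'b"
  where "descend F c = F (SOME a. a \<in> c)"

lemma descend_realization_point:
  assumes F: "\<And>a b. realization_glue X a b \<Longrightarrow> F a = F b" and a: "a \<in> topspace (prerealization X)"
  shows "descend F (realization_point X a) = F a"
proof -
  have "a \<in> realization_point X a"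
    using a by (simp add: in_realization_point realization_rel_def)
  then have "(SOME b. b \<in> realization_point X a) \<in> realization_point X a"
    by (rule someI)
  then show ?thesis
    using realization_rel_invariant[of X F, OF F] a by (simp add: descend_def in_realization_point)
qed

lemma continuous_map_descend:
  assumes F: "\<And>a b. realization_glue X a b \<Longrightarrow> F a = F b" and cont: "continuous_map (prerealization X) Y F"
  shows "continuous_map (realization X) Y (descend F)"
proof (rule continuous_compose_quotient_map[OF quotient_map_realization_point])
  show "continuous_map (prerealization X) Y (descend F \<circ> realization_point X)"
    by (rule continuous_map_eq[OF cont]) (simp add: descend_realization_point[of X F, OF F])
qed

text \<open>A homotopy may be specified before dividing by the gluing relation: the product of a quotient map with
  the unit interval is again a quotient map, as the interval is locally compact.\<close>

lemma homotopic_with_descend: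
  assumes F: "\<And>s a b. s \<in> {0..1} \<Longrightarrow> realization_glue X a b \<Longrightarrow> F (s, a) = F (s, b)"
    and cont: "continuous_map (prod_topology (top_of_set {0..1::real}) (prerealization X)) Y F"
    and p: "\<And>a. a \<in> topspace (prerealization X) \<Longrightarrow> p (realization_point X a) = F (0, a)"
    and q: "\<And>a. a \<in> topspace (prerealization X) \<Longrightarrow> q (realization_point X a) = F (1, a)"
  shows "homotopic_with (\<lambda>x. True) (realization X) Y p q"
proof -
  let ?I = "top_of_set {0..1::real}"
  let ?H = "\<lambda>(s, c). descend (\<lambda>a. F (s, a)) c"
  have desc: "descend (\<lambda>a. F (s, a)) (realization_point X a) = F (s, a)"
    if "s \<in> {0..1}" "a \<in> topspace (prerealization X)" for s a
    using that by (intro descend_realization_point[where F = "\<lambda>a. F (s, a)"] F)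
  have "quotient_map (prod_topology ?I (prerealization X)) (prod_topology ?I (realization X))
      (\<lambda>(s, a). (s, realization_point X a))"
  proof (rule quotient_map_prod_right[OF _ _ quotient_map_realization_point])
    show "locally_compact_space ?I"
      by (intro compact_imp_locally_compact_space compact_space_subtopology) auto
    show "Hausdorff_space ?I \<or> regular_space ?I"
      by (simp add: Hausdorff_space_subtopology)
  qed
  moreover have "continuous_map (prod_topology ?I (prerealization X)) Y
      (?H \<circ> (\<lambda>(s, a). (s, realization_point X a)))"
    by (rule continuous_map_eq[OF cont]) (auto simp: desc)
  ultimately have "continuous_map (prod_topology ?I (realization X)) Y ?H"
    by (rule continuous_compose_quotient_map)
  then have "homotopic_with (\<lambda>x. True) (realization X) Y (\<lambda>c. ?H (0, c)) (\<lambda>c. ?H (1, c))"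
    unfolding homotopic_with_def by blast
  then show ?thesis
    by (rule homotopic_with_eq) (auto elim!: topspace_realizationE simp: desc p q)
qed

section \<open>The realization of the tuples spanning a simplex\<close>

lemma standard_simplex_list:
  assumes "y \<noteq> []"
  shows "l \<in> standard_simplex (length y - Suc 0) \<longleftrightarrow>
    (\<forall>i. 0 \<le> l i) \<and> (\<forall>i\<ge>length y. l i = 0) \<and> (\<Sum>i<length y. l i) = 1"
proof -
  have "{..length y - Suc 0} = {..<length y}" and *: "i > length y - Suc 0 \<longleftrightarrow> i \<ge> length y" for i
    using assms by (cases y; auto)+
  moreover have "l i \<le> 1" if "\<forall>i. 0 \<le> l i" "\<forall>i\<ge>length y. l i = 0" "(\<Sum>i<length y. l i) = 1" for i
  proof (cases "i < length y")
    case True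
    then have "l i \<le> (\<Sum>i<length y. l i)"
      using that by (intro member_le_sum) auto
    then show ?thesis using that by simp
  qed (use that in auto)
  ultimately show ?thesis
    unfolding standard_simplex_def mem_Collect_eq * by auto
qed

definition tuple_point :: "'v set set \<Rightarrow> 'v list \<Rightarrow> (nat \<Rightarrow> real) \<Rightarrow> (nat \<times> 'v list \<times> (nat \<Rightarrow> real)) set"
  where "tuple_point K y l = realization_point (tuple_sset K) (length y - 1, y, l)"

text \<open>The gluing relation in the form in which it is used: a point with coordinates \<open>l\<close> on the tuple \<open>u\<close> may be
  moved to a tuple \<open>w\<close> that restricts to \<open>u\<close> along \<open>\<beta>\<close>, the coordinates being summed over the
  fibres of \<open>\<beta>\<close>. Entries outside the image of \<open>\<beta>\<close> receive coordinate 0.\<close>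

lemma tuple_point_eqI:
  assumes K: "abstract_simplicial_complex K" and w: "set w \<in> K" and u: "u \<noteq> []"
    and l: "l \<in> standard_simplex (length u - 1)"
    and mono: "mono_on {..<length u} \<beta>"
    and \<beta>: "\<And>i. i < length u \<Longrightarrow> \<beta> i < length w \<and> u ! i = w ! \<beta> i"
    and l': "\<And>j. l' j = (\<Sum>i | i < length u \<and> \<beta> i = j. l i)"
  shows "tuple_point K u l = tuple_point K w l'"
proof -
  let ?X = "tuple_sset K"
  define m n where "m = length u - 1" and "n = length w - 1"
  have "w \<noteq> []"
    using \<beta>[of 0] u by auto
  then have lens: "length u = Suc m" "length w = Suc n"
    using u by (auto simp: m_def n_def)
  have "{..m} = {..<length u}"
    using lens by auto
  then have "\<beta> \<in> simplex_maps m n"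
    using mono \<beta> lens by (auto simp: simplex_maps_def less_Suc_eq_le)
  moreover have "w \<in> simp ?X n"
    using w lens by (simp add: tuple_sset_def)
  ultimately have "realization_glue ?X (m, pull ?X m n \<beta> w, l) (n, w, simplex_push m \<beta> l)"
    using l by (intro realization_glue.intros) (simp_all add: m_def)
  moreover have "pull ?X m n \<beta> w = u"
    using \<beta> lens by (intro nth_equalityI) (auto simp: tuple_sset_def nth_reindex)
  moreover have push: "simplex_push m \<beta> l = l'"
    by (simp add: simplex_push_def l' lens less_Suc_eq_le fun_eq_iff)
  ultimately have glue: "realization_glue ?X (m, u, l) (n, w, l')"
    by simp
  have "set u \<subseteq> set w"
    using \<beta> by (metis in_set_conv_nth subsetI)
  then have "set u \<in> K"
    using asc_face[OF K w] u by simp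
  have l_pos: "\<forall>i. 0 \<le> l i" and l_sum: "(\<Sum>i<length u. l i) = 1"
    using l u by (auto simp: standard_simplex_list)
  have "(\<Sum>j<length w. l' j) = (\<Sum>j<length w. \<Sum>i | i \<in> {..<length u} \<and> \<beta> i = j. l i)"
    by (simp add: l')
  also have "\<dots> = 1"
    using \<beta> l_sum by (subst sum.group) auto
  finally have "(\<Sum>j<length w. l' j) = 1" .
  moreover have "l' j = 0" if "j \<ge> length w" for j
  proof -
    have "{i. i < length u \<and> \<beta> i = j} = {}"
      using \<beta> that by fastforce
    then show ?thesis
      by (metis l' sum.empty)
  qed
  ultimately have "l' \<in> standard_simplex n"
    using l_pos \<open>w \<noteq> []\<close> by (auto simp: standard_simplex_list n_def l' intro: sum_nonneg)
  then have "((m, u, l), (n, w, l')) \<in> realization_rel ?X"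
    using r_into_equivclp[of "realization_glue ?X", OF glue] l lens w \<open>set u \<in> K\<close>
    by (simp add: realization_rel_def topspace_prerealization tuple_sset_def)
  then show ?thesis
    unfolding tuple_point_def realization_point_def m_def n_def
    by (rule equiv_class_eq[OF equiv_realization_rel])
qed

definition barycentric :: "'v list \<Rightarrow> (nat \<Rightarrow> real) \<Rightarrow> 'v \<Rightarrow> real"
  where "barycentric y l v = (\<Sum>i | i < length y \<and> y ! i = v. l i)"

lemma barycentric_in_face:
  assumes "y \<noteq> []" "l \<in> standard_simplex (length y - 1)"
  shows "barycentric y l \<in> geometric_face (set y)"
proof -
  have "(\<Sum>v\<in>set y. barycentric y l v) = (\<Sum>v\<in>set y. \<Sum>i | i \<in> {..<length y} \<and> y ! i = v. l i)"
    by (simp add: barycentric_def)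
  also have "\<dots> = (\<Sum>i<length y. l i)"
    by (subst sum.group) auto
  finally have "sum (barycentric y l) (set y) = 1"
    using assms by (simp add: standard_simplex_list)
  moreover have "barycentric y l v = 0" if "v \<notin> set y" for v
  proof -
    have "{i. i < length y \<and> y ! i = v} = {}"
      using that by auto
    then show ?thesis
      unfolding barycentric_def by (metis sum.empty)
  qed
  ultimately show ?thesis
    using assms by (auto simp: geometric_face_def standard_simplex_list barycentric_def intro: sum_nonneg)
qed

lemma barycentric_reindex:
  assumes \<alpha>: "\<alpha> \<in> simplex_maps m n" and len: "length y = Suc n"
  shows "barycentric (reindex m \<alpha> y) l = barycentric y (simplex_push m \<alpha> l)"
proof
  fix v
  let ?A = "{i. i \<le> m \<and> y ! \<alpha> i = v}" and ?B = "{j. j < length y \<and> y ! j = v}"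
  have "barycentric (reindex m \<alpha> y) l v = sum l ?A"
    unfolding barycentric_def by (rule sum.cong) (auto simp: nth_reindex less_Suc_eq_le)
  also have "\<dots> = (\<Sum>j\<in>?B. \<Sum>i | i \<in> ?A \<and> \<alpha> i = j. l i)"
    using \<alpha> len by (subst sum.group) (auto simp: simplex_maps_def less_Suc_eq_le)
  also have "\<dots> = (\<Sum>j\<in>?B. simplex_push m \<alpha> l j)"
    unfolding simplex_push_def by (intro sum.cong refl) auto
  finally show "barycentric (reindex m \<alpha> y) l v = barycentric y (simplex_push m \<alpha> l) v"
    by (simp add: barycentric_def)
qed

definition coordinates :: "'v list \<Rightarrow> ('v \<Rightarrow> real) \<Rightarrow> nat \<Rightarrow> real"
  where "coordinates z x i = (if i < length z then x (z ! i) else 0)"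

lemma coordinates_in_simplex:
  assumes "distinct z" "z \<noteq> []" "x \<in> geometric_face (set z)"
  shows "coordinates z x \<in> standard_simplex (length z - 1)"
proof -
  have "(\<Sum>i<length z. x (z ! i)) = sum x (set z)"
    by (rule sum.reindex_bij_betw[OF bij_betw_nth[OF \<open>distinct z\<close> refl refl]])
  then show ?thesis
    using assms by (auto simp: standard_simplex_list coordinates_def geometric_face_def)
qed

lemma barycentric_coordinates:
  assumes "distinct z" "x \<in> geometric_face (set z)"
  shows "barycentric z (coordinates z x) = x"
proof
  fix v
  show "barycentric z (coordinates z x) v = x v"
  proof (cases "v \<in> set z")
    case True
    then obtain i where i: "i < length z" "z ! i = v"
      by (auto simp: in_set_conv_nth)
    then have "{j. j < length z \<and> z ! j = v} = {i}"
      using \<open>distinct z\<close> by (auto simp: nth_eq_iff_index_eq)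
    then show ?thesis
      using i by (simp add: barycentric_def coordinates_def)
  next
    case False
    then have no: "{j. j < length z \<and> z ! j = v} = {}"
      by auto
    show ?thesis
      unfolding barycentric_def no using assms False by (simp add: geometric_face_def)
  qed
qed

text \<open>Since \<open>z'\<close> has no duplicates, a position outside the image of \<open>\<iota>\<close> holds a vertex that is not an
  entry of \<open>z\<close>, and \<open>x\<close> vanishes there.\<close>

lemma coordinates_push:
  assumes z: "distinct z" and z': "distinct z'"
    and x: "x \<in> geometric_face (set z)"
    and \<iota>: "\<And>i. i < length z \<Longrightarrow> \<iota> i < length z' \<and> z ! i = z' ! \<iota> i"
  shows "coordinates z' x j = (\<Sum>i | i < length z \<and> \<iota> i = j. coordinates z x i)"
proof (cases "\<exists>i<length z. \<iota> i = j")
  case True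
  then obtain i where i: "i < length z" "\<iota> i = j" by auto
  have "{k. k < length z \<and> \<iota> k = j} = {i}"
    using i \<iota> z by (auto simp: nth_eq_iff_index_eq) (metis nth_eq_iff_index_eq)
  then show ?thesis
    using i \<iota>[of i] by (simp add: coordinates_def)
next
  case False
  then have no: "{k. k < length z \<and> \<iota> k = j} = {}"
    by auto
  have "z' ! j \<notin> set z" if "j < length z'"
    using False \<iota> z' that by (metis in_set_conv_nth nth_eq_iff_index_eq)
  then show ?thesis
    unfolding no using x by (auto simp: coordinates_def geometric_face_def)
qed

lemma filter_index:
  "\<exists>\<iota>. mono_on {..<length (filter P xs)} \<iota> \<and>
     (\<forall>i<length (filter P xs). \<iota> i < length xs \<and> filter P xs ! i = xs ! \<iota> i)"
proof (induction xs)
  case (Cons x xs)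
  then obtain \<iota> where mono: "mono_on {..<length (filter P xs)} \<iota>"
    and \<iota>: "\<And>i. i < length (filter P xs) \<Longrightarrow> \<iota> i < length xs \<and> filter P xs ! i = xs ! \<iota> i"
    by blast
  show ?case
  proof (cases "P x")
    case True
    let ?\<iota> = "\<lambda>i. case i of 0 \<Rightarrow> 0 | Suc i \<Rightarrow> Suc (\<iota> i)"
    have "mono_on {..<length (filter P (x # xs))} ?\<iota>"
      using mono True by (auto simp: mono_on_def split: nat.split)
    moreover have "?\<iota> i < length (x # xs) \<and> filter P (x # xs) ! i = (x # xs) ! ?\<iota> i"
      if "i < length (filter P (x # xs))" for i
      using that True \<iota> by (cases i) auto
    ultimately show ?thesis by blast
  next
    case False
    then show ?thesis
      using mono \<iota> by (intro exI[of _ "\<lambda>i. Suc (\<iota> i)"]) (auto simp: mono_on_def)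
  qed
qed (auto simp: mono_on_def)

section \<open>The homotopy equivalence\<close>

text \<open>A fixed list \<open>vs\<close> of the vertices gives every simplex a canonical tuple, in such a way that the tuple of
  a face is obtained from that of the simplex by omitting entries.\<close>

definition enumerate_in :: "'v list \<Rightarrow> 'v set \<Rightarrow> 'v list"
  where "enumerate_in vs \<sigma> = filter (\<lambda>v. v \<in> \<sigma>) vs"

text \<open>The point at time \<open>s\<close> on the straight line, inside the simplex spanned by the concatenated tuple
  \<open>y @ z\<close>, from the point with coordinates \<open>l\<close> on the block \<open>y\<close> to the point on the block \<open>z\<close> that has
  the same barycentric image.\<close>

definition join_coordinates :: "'v list \<Rightarrow> 'v list \<Rightarrow> real \<Rightarrow> (nat \<Rightarrow> real) \<Rightarrow> nat \<Rightarrow> real"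
  where "join_coordinates y z s l i = (if i < length y then (1 - s) * l i
           else s * coordinates z (barycentric y l) (i - length y))"

lemma join_coordinates_in_simplex:
  assumes y: "y \<noteq> []" "l \<in> standard_simplex (length y - 1)" and z: "distinct z" "set z = set y"
    and s: "s \<in> {0..1}"
  shows "join_coordinates y z s l \<in> standard_simplex (length (y @ z) - 1)"
proof -
  have "z \<noteq> []" using y z by auto
  then have c: "coordinates z (barycentric y l) \<in> standard_simplex (length z - 1)"
    using coordinates_in_simplex[OF z(1)] barycentric_in_face[OF y] z by simp
  have "(\<Sum>i<length (y @ z). join_coordinates y z s l i)
      = (\<Sum>i<length y. join_coordinates y z s l i) + (\<Sum>i<length z. join_coordinates y z s l (length y + i))"
    unfolding length_append lessThan_atLeast0
    by (subst sum.atLeastLessThan_concat[of 0 "length y", symmetric])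
      (simp_all add: sum.shift_bounds_nat_ivl[of _ 0 "length y" "length z", simplified, symmetric] add.commute)
  also have "\<dots> = (1 - s) * (\<Sum>i<length y. l i) + s * (\<Sum>i<length z. coordinates z (barycentric y l) i)"
    by (simp add: join_coordinates_def sum_distrib_left)
  finally have "(\<Sum>i<length (y @ z). join_coordinates y z s l i) = 1"
    using y c \<open>z \<noteq> []\<close> by (simp add: standard_simplex_list)
  moreover have "0 \<le> join_coordinates y z s l i" for i
    using y c s \<open>z \<noteq> []\<close> by (auto simp: standard_simplex_list join_coordinates_def)
  moreover have "join_coordinates y z s l i = 0" if "i \<ge> length (y @ z)" for i
    using that by (auto simp: join_coordinates_def coordinates_def)
  ultimately show ?thesis
    using standard_simplex_list[of "y @ z"] y(1) by simp
qed

lemma continuous_on_barycentric: "continuous_on S (\<lambda>l. barycentric y l)"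
  unfolding barycentric_def
  by (intro continuous_on_coordinatewise_then_product continuous_on_sum
      continuous_on_subset[OF continuous_on_product_coordinates subset_UNIV])

lemma continuous_on_coordinates: "continuous_on S (\<lambda>x. coordinates z x)"
proof (rule continuous_on_coordinatewise_then_product)
  show "continuous_on S (\<lambda>x. coordinates z x i)" for i
    unfolding coordinates_def
    by (cases "i < length z")
      (auto intro: continuous_on_subset[OF continuous_on_product_coordinates subset_UNIV])
qed

lemma continuous_on_join_coordinates: "continuous_on S (\<lambda>(s, l). join_coordinates y z s l)"
  unfolding case_prod_unfold
proof (rule continuous_on_coordinatewise_then_product)
  fix i
  have l: "continuous_on S (\<lambda>p. snd p i)" for i :: nat
    by (rule continuous_on_compose2[OF continuous_on_product_coordinates continuous_on_snd]) auto
  have "continuous_on UNIV (\<lambda>l. coordinates z (barycentric y l) j)" for j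
    by (rule continuous_on_compose2[OF continuous_on_product_coordinates
          continuous_on_compose2[OF continuous_on_coordinates continuous_on_barycentric]]) auto
  then have c: "continuous_on S (\<lambda>p. coordinates z (barycentric y (snd p)) j)" for j
    by (rule continuous_on_compose2) (auto intro: continuous_on_snd)
  show "continuous_on S (\<lambda>p. join_coordinates y z (fst p) (snd p) i)"
    unfolding join_coordinates_def by (cases "i < length y") (auto intro!: continuous_intros l c)
qed

lemma continuous_map_tuple_point:
  assumes w: "set w \<in> K" "w \<noteq> []" and "continuous_map Z (top_of_set (standard_simplex (length w - 1))) c"
  shows "continuous_map Z (realization (tuple_sset K)) (\<lambda>z. tuple_point K w (c z))"
proof -
  have "w \<in> simp (tuple_sset K) (length w - 1)"
    using w by (simp add: tuple_sset_def)
  from continuous_map_compose[OF continuous_map_compose[OF assms(3) continuous_map_cell[OF this]]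
      quotient_imp_continuous_map[OF quotient_map_realization_point]]
  show ?thesis
    by (simp add: o_def tuple_point_def)
qed

text \<open>The natural map, linear on every simplex, that sends the vertices of the cell of a tuple \<open>y\<close> to the
  entries of \<open>y\<close>. It does not depend on the complex, which makes it natural.\<close>

definition realization_to_complex ::
    "(nat \<times> 'v list \<times> (nat \<Rightarrow> real)) set \<Rightarrow> 'v \<Rightarrow> real"
  where "realization_to_complex = descend (\<lambda>(n, y, l). barycentric y l)"

lemma barycentric_glue:
  "realization_glue (tuple_sset K) a b \<Longrightarrow>
    (case a of (n, y, l) \<Rightarrow> barycentric y l) = (case b of (n, y, l) \<Rightarrow> barycentric y l)"
  by (induction rule: realization_glue.induct) (simp add: tuple_sset_def barycentric_reindex)

lemma realization_to_complex_point:
  "(n, y, l) \<in> topspace (prerealization (tuple_sset K)) \<Longrightarrow>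
    realization_to_complex (realization_point (tuple_sset K) (n, y, l)) = barycentric y l"
  by (subst realization_to_complex_def, subst descend_realization_point) (rule barycentric_glue, simp_all)

lemma topspace_tuples:
  "topspace (prerealization (tuple_sset K)) =
    {(n, y, l). length y = Suc n \<and> set y \<in> K \<and> l \<in> standard_simplex (length y - 1)}"
  by (auto simp: topspace_prerealization tuple_sset_def)

lemma realization_to_complex_tuple_point:
  assumes "set y \<in> K" "y \<noteq> []" "l \<in> standard_simplex (length y - 1)"
  shows "realization_to_complex (tuple_point K y l) = barycentric y l"
  using assms by (simp add: tuple_point_def realization_to_complex_point topspace_tuples)

lemma continuous_map_realization_to_complex:
  "continuous_map (realization (tuple_sset K)) (complex_realization K) realization_to_complex"
  unfolding realization_to_complex_def
proof (rule continuous_map_descend[OF barycentric_glue], assumption, rule continuous_map_from_prerealization)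
  fix n and y :: "'a list" assume "y \<in> simp (tuple_sset K) n"
  then have y: "length y = Suc n" "set y \<in> K" by (auto simp: tuple_sset_def)
  then have "barycentric y ` standard_simplex n \<subseteq> geometric_face (set y)"
    using barycentric_in_face[of y] by force
  from continuous_map_into_complex[OF y(2) continuous_on_barycentric this]
  show "continuous_map (top_of_set (standard_simplex n)) (complex_realization K)
      (\<lambda>l. case (n, y, l) of (n, y, l) \<Rightarrow> barycentric y l)"
    by simp
qed

context
  fixes K :: "'v set set" and vs :: "'v list"
  assumes K: "abstract_simplicial_complex K" and vs: "distinct vs" "\<Union>K \<subseteq> set vs"
begin

abbreviation "vertex_list \<equiv> enumerate_in vs"

lemma enum_simplex:
  assumes "\<sigma> \<in> K"
  shows "distinct (vertex_list \<sigma>)" "set (vertex_list \<sigma>) = \<sigma>" "vertex_list \<sigma> \<noteq> []"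
proof -
  show "distinct (vertex_list \<sigma>)" and *: "set (vertex_list \<sigma>) = \<sigma>"
    using assms vs by (auto simp: enumerate_in_def)
  have "\<sigma> \<noteq> {}"
    using assms K by (simp add: abstract_simplicial_complex_def)
  then show "vertex_list \<sigma> \<noteq> []"
    using * by auto
qed

lemma enum_index:
  assumes "\<tau> \<subseteq> \<sigma>"
  obtains \<iota> where "mono_on {..<length (vertex_list \<tau>)} \<iota>"
    and "\<And>i. i < length (vertex_list \<tau>) \<Longrightarrow> \<iota> i < length (vertex_list \<sigma>) \<and> vertex_list \<tau> ! i = vertex_list \<sigma> ! \<iota> i"
proof -
  have "filter (\<lambda>v. v \<in> \<tau>) (vertex_list \<sigma>) = vertex_list \<tau>"
    using assms by (auto simp: enumerate_in_def intro: filter_cong)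
  then show ?thesis
    using filter_index[of "\<lambda>v. v \<in> \<tau>" "vertex_list \<sigma>"] that by auto
qed

text \<open>The inverse up to homotopy. It uses the tuple of the smallest face that contains the point; by the next
  lemma any larger face gives the same point, and this yields continuity on each closed face.\<close>

definition complex_to_realization :: "('v \<Rightarrow> real) \<Rightarrow> (nat \<times> 'v list \<times> (nat \<Rightarrow> real)) set"
  where "complex_to_realization x = (let z = vertex_list {v. x v \<noteq> 0} in tuple_point K z (coordinates z x))"

lemma complex_to_realization_face:
  assumes \<sigma>: "\<sigma> \<in> K" and x: "x \<in> geometric_face \<sigma>"
  shows "complex_to_realization x = tuple_point K (vertex_list \<sigma>) (coordinates (vertex_list \<sigma>) x)"
proof -
  define \<tau> where "\<tau> = {v. x v \<noteq> 0}"
  have sub: "\<tau> \<subseteq> \<sigma>"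
    using x by (auto simp: \<tau>_def geometric_face_def)
  have "\<tau> \<noteq> {}"
  proof
    assume "\<tau> = {}"
    then have "sum x \<sigma> = 0"
      by (intro sum.neutral) (auto simp: \<tau>_def)
    then show False
      using x by (simp add: geometric_face_def)
  qed
  with sub have \<tau>: "\<tau> \<in> K"
    using asc_face[OF K \<sigma>] by blast
  have "sum x \<tau> = sum x \<sigma>"
    using sub \<sigma> K by (intro sum.mono_neutral_left) (auto simp: \<tau>_def abstract_simplicial_complex_def)
  then have x\<tau>: "x \<in> geometric_face (set (vertex_list \<tau>))"
    unfolding enum_simplex(2)[OF \<tau>] using x by (auto simp: geometric_face_def \<tau>_def)
  obtain \<iota> where mono: "mono_on {..<length (vertex_list \<tau>)} \<iota>"
    and \<iota>: "\<And>i. i < length (vertex_list \<tau>) \<Longrightarrow> \<iota> i < length (vertex_list \<sigma>) \<and> vertex_list \<tau> ! i = vertex_list \<sigma> ! \<iota> i"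
    using enum_index[OF sub] by blast
  have "tuple_point K (vertex_list \<tau>) (coordinates (vertex_list \<tau>) x) = tuple_point K (vertex_list \<sigma>) (coordinates (vertex_list \<sigma>) x)"
    using enum_simplex[OF \<tau>] enum_simplex[OF \<sigma>] \<sigma> x\<tau>
    by (intro tuple_point_eqI[OF K _ _ _ mono \<iota>] coordinates_in_simplex coordinates_push[OF _ _ _ \<iota>]) auto
  then show ?thesis
    by (simp add: complex_to_realization_def \<tau>_def)
qed

lemma continuous_map_complex_to_realization:
  "continuous_map (complex_realization K) (realization (tuple_sset K)) complex_to_realization"
proof (rule continuous_map_from_complex)
  fix \<sigma> assume \<sigma>: "\<sigma> \<in> K"
  note z = enum_simplex[OF \<sigma>]
  have "continuous_map (top_of_set (geometric_face \<sigma>)) (top_of_set (standard_simplex (length (vertex_list \<sigma>) - 1)))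
      (coordinates (vertex_list \<sigma>))"
    using coordinates_in_simplex[OF z(1,3)] z(2) continuous_on_coordinates
    by (auto simp: continuous_map_in_subtopology)
  then have "continuous_map (top_of_set (geometric_face \<sigma>)) (realization (tuple_sset K))
      (\<lambda>x. tuple_point K (vertex_list \<sigma>) (coordinates (vertex_list \<sigma>) x))"
    using z \<sigma> by (intro continuous_map_tuple_point) auto
  then show "continuous_map (top_of_set (geometric_face \<sigma>)) (realization (tuple_sset K)) complex_to_realization"
    by (rule continuous_map_eq) (simp add: complex_to_realization_face[OF \<sigma>])
qed

lemma complex_realization_retract:
  assumes "x \<in> topspace (complex_realization K)"
  shows "realization_to_complex (complex_to_realization x) = x"
proof -
  obtain \<sigma> where \<sigma>: "\<sigma> \<in> K" "x \<in> geometric_face \<sigma>"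
    using assms by auto
  then show ?thesis
    using enum_simplex[OF \<sigma>(1)] coordinates_in_simplex[of "vertex_list \<sigma>" x]
    by (simp add: complex_to_realization_face realization_to_complex_tuple_point barycentric_coordinates)
qed

text \<open>The tuple \<open>y @ z\<close>, where \<open>z\<close> lists the entries of \<open>y\<close> in the fixed order, has the same set of entries as
  \<open>y\<close>, so it is a simplex of the tuple complex. Inside it the given point is joined to its image under
  \<open>complex_to_realization \<circ> realization_to_complex\<close>.\<close>

definition join_homotopy ::
    "real \<times> nat \<times> 'v list \<times> (nat \<Rightarrow> real) \<Rightarrow> (nat \<times> 'v list \<times> (nat \<Rightarrow> real)) set"
  where "join_homotopy = (\<lambda>(s, n, y, l).
    let z = vertex_list (set y) in tuple_point K (y @ z) (join_coordinates y z s l))"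

text \<open>A structure map \<open>\<alpha>\<close> from \<open>y\<close> to \<open>u = \<alpha>\<^sup>*y\<close> extends to the concatenated tuples: it acts by \<open>\<alpha>\<close> on the first
  block, and on the second by the inclusion of positions, because the entries of \<open>u\<close> are among those of
  \<open>y\<close> and are listed in the same order.\<close>

lemma join_homotopy_glue:
  assumes s: "s \<in> {0..1}" and glue: "realization_glue (tuple_sset K) a b"
  shows "join_homotopy (s, a) = join_homotopy (s, b)"
  using glue
proof cases
  case (1 \<alpha> m n y l)
  define u where "u = reindex m \<alpha> y"
  define l' where "l' = simplex_push m \<alpha> l"
  have y: "length y = Suc n" "set y \<in> K" and u: "length u = Suc m"
    using 1 by (auto simp: tuple_sset_def u_def)
  have \<alpha>: "\<alpha> i < length y" "u ! i = y ! \<alpha> i" if "i < length u" for i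
    using 1 that y u by (auto simp: simplex_maps_def u_def nth_reindex less_Suc_eq_le)
  then have sub: "set u \<subseteq> set y"
    by (metis in_set_conv_nth nth_mem subsetI)
  moreover have "u \<noteq> []" using u by auto
  ultimately have uK: "set u \<in> K"
    using asc_face[OF K y(2)] by simp
  note zu = enum_simplex[OF uK] and zy = enum_simplex[OF y(2)]
  have l: "l \<in> standard_simplex (length u - 1)"
    using 1 u by simp
  have bary: "barycentric u l = barycentric y l'"
    unfolding u_def l'_def using 1 y by (intro barycentric_reindex)
  have x: "barycentric u l \<in> geometric_face (set (vertex_list (set u)))"
    unfolding zu(2) by (intro barycentric_in_face l \<open>u \<noteq> []\<close>)
  obtain \<iota> where mono: "mono_on {..<length (vertex_list (set u))} \<iota>"
    and \<iota>: "\<And>i. i < length (vertex_list (set u)) \<Longrightarrow>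
      \<iota> i < length (vertex_list (set y)) \<and> vertex_list (set u) ! i = vertex_list (set y) ! \<iota> i"
    using enum_index[OF sub] by blast
  let ?\<beta> = "\<lambda>i. if i < length u then \<alpha> i else length y + \<iota> (i - length u)"
  have "tuple_point K (u @ vertex_list (set u)) (join_coordinates u (vertex_list (set u)) s l)
      = tuple_point K (y @ vertex_list (set y)) (join_coordinates y (vertex_list (set y)) s l')"
  proof (rule tuple_point_eqI[OF K, where \<beta> = ?\<beta>])
    show "set (y @ vertex_list (set y)) \<in> K"
      using y zy by simp
    show "join_coordinates u (vertex_list (set u)) s l \<in> standard_simplex (length (u @ vertex_list (set u)) - 1)"
      by (intro join_coordinates_in_simplex \<open>u \<noteq> []\<close> l zu s)
    have mono_\<alpha>: "mono_on {..<length u} \<alpha>"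
      using 1 u by (auto simp: simplex_maps_def lessThan_Suc_atMost)
    show "mono_on {..<length (u @ vertex_list (set u))} ?\<beta>"
    proof (rule mono_onI)
      fix i j assume ij: "i \<in> {..<length (u @ vertex_list (set u))}" "j \<in> {..<length (u @ vertex_list (set u))}" "i \<le> j"
      consider "j < length u" | "i < length u" "\<not> j < length u" | "\<not> i < length u" "\<not> j < length u"
        using ij by linarith
      then show "?\<beta> i \<le> ?\<beta> j"
      proof cases
        case 1
        then show ?thesis
          using ij mono_onD[OF mono_\<alpha>, of i j] by auto
      next
        case 2
        then show ?thesis
          using \<alpha>(1)[of i] by simp
      next
        case 3
        then show ?thesis
          using ij mono_onD[OF mono, of "i - length u" "j - length u"] by auto
      qed
    qed
    show "?\<beta> i < length (y @ vertex_list (set y)) \<and> (u @ vertex_list (set u)) ! i = (y @ vertex_list (set y)) ! ?\<beta> i"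
      if "i < length (u @ vertex_list (set u))" for i
      using that \<alpha> \<iota>[of "i - length u"] by (auto simp: nth_append)
    show "join_coordinates y (vertex_list (set y)) s l' j
        = (\<Sum>i | i < length (u @ vertex_list (set u)) \<and> ?\<beta> i = j. join_coordinates u (vertex_list (set u)) s l i)" for j
    \<comment> \<open>The first block of coordinates is a scaled push-forward along \<open>\<alpha>\<close>, the second one along \<open>\<iota>\<close>.\<close>
    proof (cases "j < length y")
      case True
      have "{i. i < length (u @ vertex_list (set u)) \<and> ?\<beta> i = j} = {i. i < length u \<and> \<alpha> i = j}"
        using True by (auto split: if_splits)
      then show ?thesis
        using True u
        by (simp add: join_coordinates_def l'_def simplex_push_def less_Suc_eq_le sum_distrib_left)
    next
      case False
      let ?J = "{k. k < length (vertex_list (set u)) \<and> \<iota> k = j - length y}"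
      have "{i. i < length (u @ vertex_list (set u)) \<and> ?\<beta> i = j} = (\<lambda>k. length u + k) ` ?J"
      proof (intro equalityI subsetI)
        fix i assume "i \<in> {i. i < length (u @ vertex_list (set u)) \<and> ?\<beta> i = j}"
        then have "\<not> i < length u" "i - length u \<in> ?J"
          using False \<alpha>(1) by (auto split: if_splits)
        then show "i \<in> (\<lambda>k. length u + k) ` ?J"
          by (intro image_eqI[of _ _ "i - length u"]) auto
      qed (use False in auto)
      then have "(\<Sum>i | i < length (u @ vertex_list (set u)) \<and> ?\<beta> i = j. join_coordinates u (vertex_list (set u)) s l i)
          = (\<Sum>k\<in>?J. s * coordinates (vertex_list (set u)) (barycentric u l) k)"
        by (simp add: sum.reindex join_coordinates_def)
      also have "\<dots> = s * coordinates (vertex_list (set y)) (barycentric u l) (j - length y)"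
        using coordinates_push[OF zu(1) zy(1) x \<iota>] by (simp add: sum_distrib_left)
      finally show ?thesis
        using False by (simp add: join_coordinates_def bary)
    qed
  qed (use \<open>u \<noteq> []\<close> in auto)
  then show ?thesis
    using 1 by (simp add: join_homotopy_def u_def l'_def tuple_sset_def Let_def)
qed

lemma continuous_map_join_homotopy:
  "continuous_map (prod_topology (top_of_set {0..1}) (prerealization (tuple_sset K)))
    (realization (tuple_sset K)) join_homotopy"
proof (rule continuous_map_from_prod_prerealization)
  fix n and y :: "'v list" assume "y \<in> simp (tuple_sset K) n"
  then have y: "length y = Suc n" "set y \<in> K" "y \<noteq> []"
    by (auto simp: tuple_sset_def)
  let ?z = "vertex_list (set y)"
  note z = enum_simplex[OF y(2)]
  have "continuous_map (top_of_set ({0..1} \<times> standard_simplex n))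
      (top_of_set (standard_simplex (length (y @ ?z) - 1))) (\<lambda>(s, l). join_coordinates y ?z s l)"
    using continuous_on_join_coordinates[of _ y ?z] join_coordinates_in_simplex[OF y(3) _ z(1,2)] y(1)
    by (auto simp: continuous_map_in_subtopology)
  from continuous_map_tuple_point[OF _ _ this, of K] y z
  have "continuous_map (top_of_set ({0..1} \<times> standard_simplex n)) (realization (tuple_sset K))
      (\<lambda>p. tuple_point K (y @ ?z) (case p of (s, l) \<Rightarrow> join_coordinates y ?z s l))"
    by simp
  moreover have "(\<lambda>(s, l). join_homotopy (s, n, y, l))
      = (\<lambda>p. tuple_point K (y @ ?z) (case p of (s, l) \<Rightarrow> join_coordinates y ?z s l))"
    by (auto simp: join_homotopy_def Let_def)
  moreover have "prod_topology (top_of_set {0..1::real}) (top_of_set (standard_simplex n))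
      = top_of_set ({0..1} \<times> standard_simplex n)"
    by (simp flip: subtopology_Times)
  ultimately show "continuous_map (prod_topology (top_of_set {0..1}) (top_of_set (standard_simplex n)))
      (realization (tuple_sset K)) (\<lambda>(s, l). join_homotopy (s, n, y, l))"
    by simp
qed

lemma join_homotopy_ends:
  assumes a: "a \<in> topspace (prerealization (tuple_sset K))"
  shows "join_homotopy (0, a) = realization_point (tuple_sset K) a"
    and "join_homotopy (1, a)
      = complex_to_realization (realization_to_complex (realization_point (tuple_sset K) a))"
proof -
  obtain n y l where nyl: "a = (n, y, l)" by (cases a)
  then have y: "length y = Suc n" "set y \<in> K" "y \<noteq> []" and l: "l \<in> standard_simplex (length y - 1)"
    using a by (auto simp: topspace_tuples)
  let ?z = "vertex_list (set y)"
  note z = enum_simplex[OF y(2)]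
  have yz: "set (y @ ?z) \<in> K"
    using y z by simp
  have x: "barycentric y l \<in> geometric_face (set y)"
    by (intro barycentric_in_face y l)
  have "tuple_point K y l = tuple_point K (y @ ?z) (join_coordinates y ?z 0 l)"
  proof (rule tuple_point_eqI[OF K yz y(3) l, where \<beta> = "\<lambda>i. i"])
    show "join_coordinates y ?z 0 l j = (\<Sum>i | i < length y \<and> i = j. l i)" for j
    proof (cases "j < length y")
      case True
      then have "{i. i < length y \<and> i = j} = {j}" by auto
      then show ?thesis using True by (simp add: join_coordinates_def)
    next
      case False
      then have no: "{i. i < length y \<and> i = j} = {}" by auto
      show ?thesis unfolding no using False by (simp add: join_coordinates_def)
    qed
  qed (auto simp: nth_append mono_on_def)
  then show "join_homotopy (0, a) = realization_point (tuple_sset K) a"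
    using y by (simp add: nyl join_homotopy_def tuple_point_def Let_def)
  have "tuple_point K ?z (coordinates ?z (barycentric y l))
      = tuple_point K (y @ ?z) (join_coordinates y ?z 1 l)"
  proof (rule tuple_point_eqI[OF K yz z(3), where \<beta> = "\<lambda>i. length y + i"])
    show "coordinates ?z (barycentric y l) \<in> standard_simplex (length ?z - 1)"
      using z x by (intro coordinates_in_simplex) auto
    show "join_coordinates y ?z 1 l j
        = (\<Sum>i | i < length ?z \<and> length y + i = j. coordinates ?z (barycentric y l) i)" for j
    proof (cases "length y \<le> j \<and> j < length (y @ ?z)")
      case True
      then have "{i. i < length ?z \<and> length y + i = j} = {j - length y}" by auto
      then show ?thesis using True by (simp add: join_coordinates_def)
    next
      case False
      then have no: "{i. i < length ?z \<and> length y + i = j} = {}" by auto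
      show ?thesis unfolding no using False by (auto simp: join_coordinates_def coordinates_def)
    qed
  qed (auto simp: mono_on_def)
  moreover have "realization_to_complex (realization_point (tuple_sset K) a) = barycentric y l"
    using a by (simp add: nyl realization_to_complex_point)
  ultimately show "join_homotopy (1, a)
      = complex_to_realization (realization_to_complex (realization_point (tuple_sset K) a))"
    using complex_to_realization_face[OF y(2) x] by (simp add: nyl join_homotopy_def Let_def)
qed

lemma homotopy_equivalence_realization_to_complex:
  "homotopy_equivalence_map (realization (tuple_sset K)) (complex_realization K) realization_to_complex"
  unfolding homotopy_equivalence_map_def
proof (intro conjI exI[of _ complex_to_realization])
  note cont = continuous_map_realization_to_complex continuous_map_complex_to_realization
  show "continuous_map (realization (tuple_sset K)) (complex_realization K) realization_to_complex"
    and "continuous_map (complex_realization K) (realization (tuple_sset K)) complex_to_realization"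
    by (rule cont)+
  have "homotopic_with (\<lambda>x. True) (realization (tuple_sset K)) (realization (tuple_sset K))
      id (complex_to_realization \<circ> realization_to_complex)"
    by (rule homotopic_with_descend[where F = join_homotopy])
      (auto simp: join_homotopy_glue join_homotopy_ends continuous_map_join_homotopy)
  then show "homotopic_with (\<lambda>x. True) (realization (tuple_sset K)) (realization (tuple_sset K))
      (complex_to_realization \<circ> realization_to_complex) id"
    by (rule homotopic_with_symD)
  show "homotopic_with (\<lambda>x. True) (complex_realization K) (complex_realization K)
      (realization_to_complex \<circ> complex_to_realization) id"
    by (intro homotopic_with_equal continuous_map_compose[OF cont(2,1)])
      (auto simp: complex_realization_retract simp del: topspace_complex_realization)
qed

end

text \<open>All members of an equivalence class for \<open>K\<close> or for \<open>L\<close> have the same barycentric image, and the class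
  for \<open>L\<close> contains the class for \<open>K\<close>.\<close>

lemma realization_to_complex_incl:
  assumes "K \<subseteq> L" and c: "c \<in> topspace (realization (tuple_sset K))"
  shows "realization_to_complex (realization_incl (tuple_sset L) c) = realization_to_complex c"
proof -
  let ?F = "\<lambda>(n, y, l). barycentric y l"
  obtain a where a: "a \<in> topspace (prerealization (tuple_sset K))" "c = realization_point (tuple_sset K) a"
    using topspace_realizationE[OF c] .
  have aL: "a \<in> topspace (prerealization (tuple_sset L))"
    using a(1) \<open>K \<subseteq> L\<close> by (auto simp: topspace_tuples)
  have invariant: "?F b = ?F b'" if "(b, b') \<in> realization_rel (tuple_sset M)" for b b' M
    by (rule realization_rel_invariant[OF _ that]) (rule barycentric_glue)
  have F_c: "?F a = ?F b" if "b \<in> c" for b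
    using that a by (intro invariant[of _ _ K]) (simp add: in_realization_point)
  have a_c: "a \<in> c"
    using a by (simp add: in_realization_point realization_rel_def)
  then have "a \<in> realization_incl (tuple_sset L) c"
    using aL by (auto simp: realization_incl_def realization_rel_def)
  then have "(SOME b. b \<in> realization_incl (tuple_sset L) c) \<in> realization_incl (tuple_sset L) c"
    by (rule someI)
  then obtain b where "b \<in> c"
    and b: "(b, SOME b. b \<in> realization_incl (tuple_sset L) c) \<in> realization_rel (tuple_sset L)"
    by (auto simp: realization_incl_def)
  have "?F b = realization_to_complex (realization_incl (tuple_sset L) c)"
    unfolding realization_to_complex_def descend_def by (rule invariant[OF b])
  moreover have "realization_to_complex c = ?F a"
    using a realization_to_complex_point by (cases a) simp
  ultimately show ?thesis
    using F_c[OF \<open>b \<in> c\<close>] by simp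
qed

theorem proposition6p7:
  fixes V :: "'v set" and d :: "'v \<Rightarrow> 'v \<Rightarrow> ennreal" and \<gamma> :: "'v \<Rightarrow> ennreal"
  assumes "finite V" and "extended_metric_on V d"
  shows "(\<exists>f. natural_homotopy_equivalence
            (\<lambda>p :: ennreal \<times> ennreal. realization (sublevel_monoidal_rips V d \<gamma> p))
            (\<lambda>p q. realization_incl (sublevel_monoidal_rips V d \<gamma> q))
            (\<lambda>p. complex_realization (sublevel_rips V d \<gamma> p))
            (\<lambda>p q x. x)
            f)
       \<and> (\<forall>n r. linear_order_on V r \<longrightarrow>
            isomorphic_persistence_modules
              (persistent_homology n (\<lambda>p :: ennreal \<times> ennreal.
                 sset_complex (sublevel_monoidal_rips V d \<gamma> p)
                   :: ('v list, 'k::field) based_complex))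
              (persistent_homology n (\<lambda>p.
                 ordered_complex r (sublevel_rips V d \<gamma> p)
                   :: ('v set, 'k) based_complex)))"
proof -
  let ?K = "sublevel_rips V d \<gamma>"
  obtain vs where vs: "set vs = V" "distinct vs"
    using finite_distinct_list[OF \<open>finite V\<close>] by blast
  have simplices: "?K p \<subseteq> Pow V - {{}}" for p
    by (cases p) (auto simp: sublevel_rips_def)
  \<comment> \<open>The full simplex on \<open>V\<close> contains all stages, so choices made for it are compatible.\<close>
  have S: "abstract_simplicial_complex (Pow V - {{}})"
    using finite_subset[OF _ \<open>finite V\<close>] unfolding abstract_simplicial_complex_def by blast
  show ?thesis
    unfolding sublevel_monoidal_rips_eq_tuple_sset[OF \<open>extended_metric_on V d\<close>]
  proof (intro conjI allI impI exI[of _ "\<lambda>_. realization_to_complex"])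
    have equivalence: "homotopy_equivalence_map (realization (tuple_sset (?K p))) (complex_realization (?K p))
        realization_to_complex" for p
      using simplices[of p] vs
      by (intro homotopy_equivalence_realization_to_complex[of _ vs]
          abstract_simplicial_complex_sublevel_rips) auto
    show "natural_homotopy_equivalence (\<lambda>p. realization (tuple_sset (?K p)))
        (\<lambda>p q. realization_incl (tuple_sset (?K q))) (\<lambda>p. complex_realization (?K p))
        (\<lambda>p q x. x) (\<lambda>_. realization_to_complex)"
      unfolding natural_homotopy_equivalence_def
      by (intro conjI allI impI ballI equivalence) (rule realization_to_complex_incl[OF sublevel_rips_mono])
    show "isomorphic_persistence_modules
        (persistent_homology n (\<lambda>p. sset_complex (tuple_sset (?K p)) :: ('v list, 'k) based_complex))
        (persistent_homology n (\<lambda>p. ordered_complex r (?K p) :: ('v set, 'k) based_complex))"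
      if "linear_order_on V r" for n r
      by (rule persistent_homology_tuples_ordered[OF that S _ abstract_simplicial_complex_sublevel_rips
            simplices sublevel_rips_mono]) auto
  qed
qed

end
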